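(* Let $\mathbb{F}$ be a field of characteristic zero. Each finite dimensional $\mathfrak{osp}(1,2)$-module over $\mathbb{F}$ is completely reducible.
   Context: $\mathbb{F}$ is a field of characteristic zero and all vector spaces are over $\mathbb{F}$. $\mathfrak{osp}(1,2)$ is the Lie subsuperalgebra of $\mathfrak{sl}(1,2)$ (the $3\times 3$ supermatrices of supertrace zero, where index $1$ has one parity and indices $2,3$ the other) with basis the odd elements $F_+=e_{12}+e_{31}$, $F_-=2e_{13}-2e_{21}$ and the even elements $H=-2e_{22}+2e_{33}$, $E_+=2e_{32}$, $E_-=-8e_{23}$ (here $e_{ij}$ are the matrix units). A module of a Lie superalgebra $\mathfrak{g}$ is a superspace $\mathcal{V}=\mathcal{V}_{\bar 0}\oplus\mathcal{V}_{\bar 1}$ with a bilinear map $\cdot:\mathfrak{g}\times\mathcal{V}\to\mathcal{V}$ satisfying $\mathfrak{g}_{\bar i}\cdot\mathcal{V}_{\bar j}\subseteq\mathcal{V}_{\bar i+\bar j}$ and $[x,y]\cdot v=x\cdot(y\cdot v)-(-1)^{|x||y|}y\cdot(x\cdot v)$ for all homogeneous $x,y\in\mathfrak{g}$ and all $v\in\mathcal{V}$. *)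

theory Defs
  imports "HOL-Analysis.Analysis" "HOL-Library.Z2"
begin

section \<open>Lie superalgebras and their modules\<close>

text \<open>Parities are elements of \<open>bit\<close>, the integers mod 2.\<close>

definition super_sign :: "bit \<Rightarrow> bit \<Rightarrow> 'k::comm_ring_1" where
  "super_sign i j = (if i = 1 \<and> j = 1 then -1 else 1)"

text \<open>A superspace is given by its two homogeneous components inside an ambient vector space,
  which may be larger than their direct sum \<open>total\<close>.\<close>

locale superspace = vector_space scale
  for scale :: "'k::field \<Rightarrow> 'v::ab_group_add \<Rightarrow> 'v" +
  fixes V :: "bit \<Rightarrow> 'v set"
  assumes subspace_component: "subspace (V i)"
    and components_Int: "V 0 \<inter> V 1 = {0}"
begin

definition total :: "'v set" where
  "total = {a + b | a b. a \<in> V 0 \<and> b \<in> V 1}"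

end

text \<open>The customary axioms in characteristic other than 2 and 3.\<close>

locale lie_superalgebra = superspace scale L
  for scale :: "'k::field \<Rightarrow> 'l::ab_group_add \<Rightarrow> 'l" and L :: "bit \<Rightarrow> 'l set" +
  fixes bracket :: "'l \<Rightarrow> 'l \<Rightarrow> 'l"
  assumes bracket_add_left:
      "\<lbrakk>x \<in> total; y \<in> total; z \<in> total\<rbrakk> \<Longrightarrow> bracket (x + y) z = bracket x z + bracket y z"
    and bracket_add_right:
      "\<lbrakk>x \<in> total; y \<in> total; z \<in> total\<rbrakk> \<Longrightarrow> bracket x (y + z) = bracket x y + bracket x z"
    and bracket_scale_left:
      "\<lbrakk>x \<in> total; y \<in> total\<rbrakk> \<Longrightarrow> bracket (scale c x) y = scale c (bracket x y)"
    and bracket_scale_right: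
      "\<lbrakk>x \<in> total; y \<in> total\<rbrakk> \<Longrightarrow> bracket x (scale c y) = scale c (bracket x y)"
    and bracket_in: "\<lbrakk>x \<in> L i; y \<in> L j\<rbrakk> \<Longrightarrow> bracket x y \<in> L (i + j)"
    and super_skew:
      "\<lbrakk>x \<in> L i; y \<in> L j\<rbrakk> \<Longrightarrow> bracket x y = - scale (super_sign i j) (bracket y x)"
    and super_Jacobi:
      "\<lbrakk>x \<in> L i; y \<in> L j; z \<in> L k\<rbrakk> \<Longrightarrow>
        bracket x (bracket y z) =
          bracket (bracket x y) z + scale (super_sign i j) (bracket y (bracket x z))"

text \<open>The module is the whole type \<open>'v\<close>; of the function \<open>act\<close> only its restriction to
  \<open>L.total\<close> in the first argument matters.\<close>

locale lie_superalgebra_module =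
  L: lie_superalgebra scaleL L bracket + superspace scale V
  for scaleL :: "'k::field \<Rightarrow> 'l::ab_group_add \<Rightarrow> 'l"
    and L :: "bit \<Rightarrow> 'l set" and bracket :: "'l \<Rightarrow> 'l \<Rightarrow> 'l"
    and scale :: "'k \<Rightarrow> 'v::ab_group_add \<Rightarrow> 'v" and V :: "bit \<Rightarrow> 'v set" +
  fixes act :: "'l \<Rightarrow> 'v \<Rightarrow> 'v"
  assumes total_eq_UNIV: "total = UNIV"
    and act_add_left:
      "\<lbrakk>x \<in> L.total; y \<in> L.total\<rbrakk> \<Longrightarrow> act (x + y) v = act x v + act y v"
    and act_add_right: "x \<in> L.total \<Longrightarrow> act x (v + w) = act x v + act x w"
    and act_scale_left: "x \<in> L.total \<Longrightarrow> act (scaleL c x) v = scale c (act x v)"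
    and act_scale_right: "x \<in> L.total \<Longrightarrow> act x (scale c v) = scale c (act x v)"
    and act_in: "\<lbrakk>x \<in> L i; v \<in> V j\<rbrakk> \<Longrightarrow> act x v \<in> V (i + j)"
    and act_bracket:
      "\<lbrakk>x \<in> L i; y \<in> L j\<rbrakk> \<Longrightarrow>
        act (bracket x y) v = act x (act y v) - scale (super_sign i j) (act y (act x v))"
begin

text \<open>Submodules are graded, i.e. the sum of their intersections with the components of \<open>V\<close>.\<close>

definition submodule :: "'v set \<Rightarrow> bool" where
  "submodule W \<longleftrightarrow>
     subspace W \<and>
     (\<forall>w\<in>W. \<exists>a\<in>W \<inter> V 0. \<exists>b\<in>W \<inter> V 1. w = a + b) \<and>
     (\<forall>x\<in>L.total. \<forall>w\<in>W. act x w \<in> W)"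

definition irreducible_submodule :: "'v set \<Rightarrow> bool" where
  "irreducible_submodule W \<longleftrightarrow>
     submodule W \<and> W \<noteq> {0} \<and> (\<forall>U. submodule U \<and> U \<subseteq> W \<longrightarrow> U = {0} \<or> U = W)"

text \<open>\<open>V\<close> is the (internal) direct sum of a set \<open>S\<close> of irreducible submodules; the zero module
  is the case of empty \<open>S\<close>.\<close>

definition completely_reducible :: bool where
  "completely_reducible \<longleftrightarrow>
     (\<exists>S. (\<forall>W\<in>S. irreducible_submodule W) \<and>
          span (\<Union>S) = UNIV \<and>
          (\<forall>W\<in>S. W \<inter> span (\<Union>(S - {W})) = {0}))"

end


section \<open>The supermatrices of size 3 and osp(1,2)\<close>

definition matrix_scale :: "'k::field \<Rightarrow> 'k^3^3 \<Rightarrow> 'k^3^3" where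
  "matrix_scale c A = (\<chi> i j. c * A $ i $ j)"

global_interpretation mat: vector_space matrix_scale
  by unfold_locales (simp_all add: matrix_scale_def vec_eq_iff algebra_simps)

text \<open>Index 1 is even, indices 2 and 3 are odd.\<close>

definition index_parity :: "3 \<Rightarrow> bit" where
  "index_parity i = (if i = 1 then 0 else 1)"

definition homogeneous_part :: "bit \<Rightarrow> 'k::field^3^3 \<Rightarrow> 'k^3^3" where
  "homogeneous_part p A =
     (\<chi> i j. if index_parity i + index_parity j = p then A $ i $ j else 0)"

text \<open>The bilinear extension of \<open>[A, B] = AB - (-1)\<^bsup>|A||B|\<^esup> BA\<close> for homogeneous \<open>A\<close>, \<open>B\<close>.\<close>

definition supercommutator :: "'k::field^3^3 \<Rightarrow> 'k^3^3 \<Rightarrow> 'k^3^3" where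
  "supercommutator A B =
     (\<Sum>p\<in>{0, 1}. \<Sum>q\<in>{0, 1}.
        homogeneous_part p A ** homogeneous_part q B
        - matrix_scale (super_sign p q) (homogeneous_part q B ** homogeneous_part p A))"

definition supertrace :: "'k::field^3^3 \<Rightarrow> 'k" where
  "supertrace A = (\<Sum>i\<in>UNIV. super_sign (index_parity i) (index_parity i) * A $ i $ i)"

definition sl12 :: "bit \<Rightarrow> ('k::field^3^3) set" where
  "sl12 p = {A. homogeneous_part p A = A \<and> supertrace A = 0}"

definition matrix_unit :: "3 \<Rightarrow> 3 \<Rightarrow> 'k::field^3^3" where
  "matrix_unit i j = (\<chi> k l. if k = i \<and> l = j then 1 else 0)"

definition osp_F_plus :: "'k::field^3^3" where
  "osp_F_plus = matrix_unit 1 2 + matrix_unit 3 1"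

definition osp_F_minus :: "'k::field^3^3" where
  "osp_F_minus = matrix_scale 2 (matrix_unit 1 3) - matrix_scale 2 (matrix_unit 2 1)"

definition osp_H :: "'k::field^3^3" where
  "osp_H = matrix_scale (-2) (matrix_unit 2 2) + matrix_scale 2 (matrix_unit 3 3)"

definition osp_E_plus :: "'k::field^3^3" where
  "osp_E_plus = matrix_scale 2 (matrix_unit 3 2)"

definition osp_E_minus :: "'k::field^3^3" where
  "osp_E_minus = matrix_scale (-8) (matrix_unit 2 3)"

definition osp12 :: "bit \<Rightarrow> ('k::field^3^3) set" where
  "osp12 p = mat.span
     (if p = 0 then {osp_H, osp_E_plus, osp_E_minus} else {osp_F_plus, osp_F_minus})"


subsection \<open>osp(1,2) is a Lie subsuperalgebra of sl(1,2)\<close>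

lemmas osp_basis_defs = osp_F_plus_def osp_F_minus_def osp_H_def osp_E_plus_def osp_E_minus_def

lemmas entry_simps = vec_eq_iff forall_3 sum_3 matrix_scale_def matrix_unit_def
  matrix_matrix_mult_def homogeneous_part_def index_parity_def supertrace_def super_sign_def

lemma bit_exhaust: "(i::bit) = 0 \<or> i = 1"
  by (cases i) auto

lemma osp_basis_in_sl12:
  "osp_H \<in> sl12 0" "osp_E_plus \<in> sl12 0" "osp_E_minus \<in> sl12 0"
  "osp_F_plus \<in> sl12 1" "osp_F_minus \<in> sl12 1"
  by (simp_all add: sl12_def osp_basis_defs entry_simps)

lemma homogeneous_part_linear:
  "homogeneous_part p (A + B) = homogeneous_part p A + homogeneous_part p B"
  "homogeneous_part p (matrix_scale c A) = matrix_scale c (homogeneous_part p A)"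
  by (simp_all add: vec_eq_iff matrix_scale_def homogeneous_part_def)

lemma supertrace_linear:
  "supertrace (A + B) = supertrace A + supertrace B"
  "supertrace (matrix_scale c A) = c * supertrace A"
  by (simp_all add: supertrace_def matrix_scale_def sum.distrib sum_distrib_left algebra_simps)

lemma subspace_sl12: "mat.subspace (sl12 p)"
proof -
  have "homogeneous_part p 0 = 0" "supertrace 0 = 0"
    by (simp_all add: homogeneous_part_def supertrace_def vec_eq_iff)
  then show ?thesis
    by (simp add: sl12_def mat.subspace_def homogeneous_part_linear supertrace_linear)
qed

lemma osp12_subset_sl12: "osp12 p \<subseteq> sl12 p"
  unfolding osp12_def
  by (rule mat.span_minimal[OF _ subspace_sl12])
    (use bit_exhaust[of p] osp_basis_in_sl12 in auto)

lemma osp12_basis_independent: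
  "mat.independent {osp_F_plus, osp_F_minus, osp_H, osp_E_plus, osp_E_minus :: 'k::field_char_0^3^3}"
  "card {osp_F_plus, osp_F_minus, osp_H, osp_E_plus, osp_E_minus :: 'k::field_char_0^3^3} = 5"
proof -
  let ?Fp = "osp_F_plus :: 'k^3^3" and ?Fm = "osp_F_minus :: 'k^3^3" and ?H = "osp_H :: 'k^3^3"
    and ?Ep = "osp_E_plus :: 'k^3^3" and ?Em = "osp_E_minus :: 'k^3^3"
  have entry: "x \<notin> mat.span S" if "\<forall>y\<in>S. y $ i $ j = 0" "x $ i $ j \<noteq> 0"
    for x :: "'k^3^3" and S i j
  proof -
    have "mat.subspace {y. y $ i $ j = 0}"
      by (auto simp: mat.subspace_def matrix_scale_def)
    then have "mat.span S \<subseteq> {y. y $ i $ j = 0}"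
      using that(1) by (intro mat.span_minimal) auto
    then show ?thesis
      using that(2) by auto
  qed
  note simps = osp_basis_defs matrix_scale_def matrix_unit_def
  have 1: "?Fp \<notin> mat.span {?Fm, ?H, ?Ep, ?Em}"
    by (rule entry[of _ 1 2]) (simp_all add: simps)
  have 2: "?Fm \<notin> mat.span {?H, ?Ep, ?Em}"
    by (rule entry[of _ 1 3]) (simp_all add: simps)
  have 3: "?H \<notin> mat.span {?Ep, ?Em}"
    by (rule entry[of _ 2 2]) (simp_all add: simps)
  have 4: "?Ep \<notin> mat.span {?Em}"
    by (rule entry[of _ 3 2]) (simp_all add: simps)
  have 5: "?Em \<notin> mat.span {}"
    by (rule entry[of _ 2 3]) (simp_all add: simps)
  note sp = 1 2 3 4 5
  show "mat.independent {?Fp, ?Fm, ?H, ?Ep, ?Em}"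
    by (intro mat.independent_insertI mat.independent_empty sp)
  have "?Fp \<notin> {?Fm, ?H, ?Ep, ?Em}" "?Fm \<notin> {?H, ?Ep, ?Em}" "?H \<notin> {?Ep, ?Em}" "?Ep \<notin> {?Em}"
    by (rule contra_subsetD[OF mat.span_superset], rule sp)+
  then show "card {?Fp, ?Fm, ?H, ?Ep, ?Em} = 5"
    by simp
qed

lemma mat_mult_distribs:
  fixes A B C :: "'k::field^3^3"
  shows "A ** (B + C) = A ** B + A ** C" "(A + B) ** C = A ** C + B ** C"
    "A ** (B - C) = A ** B - A ** C" "(A - B) ** C = A ** C - B ** C"
    "matrix_scale c A ** B = matrix_scale c (A ** B)"
    "A ** matrix_scale c B = matrix_scale c (A ** B)"
    "(- A) ** B = - (A ** B)" "A ** (- B) = - (A ** B)"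
    "A ** 0 = 0" "0 ** A = 0"
  by (simp_all add: vec_eq_iff matrix_scale_def matrix_matrix_mult_def algebra_simps
      sum.distrib sum_subtractf sum_negf sum_distrib_left)

lemma supercommutator_bilinear:
  "supercommutator (A + B) C = supercommutator A C + supercommutator B C"
  "supercommutator A (B + C) = supercommutator A B + supercommutator A C"
  "supercommutator (matrix_scale c A) B = matrix_scale c (supercommutator A B)"
  "supercommutator A (matrix_scale c B) = matrix_scale c (supercommutator A B)"
  by (simp_all add: supercommutator_def homogeneous_part_linear mat_mult_distribs algebra_simps
      super_sign_def)

lemma homogeneous_part_other:
  assumes "homogeneous_part p A = A" "q \<noteq> p"
  shows "homogeneous_part q A = 0"
  by (subst assms(1)[symmetric]) (use assms(2) in \<open>auto simp: vec_eq_iff homogeneous_part_def\<close>)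

lemma supercommutator_homogeneous:
  assumes "homogeneous_part p A = A" "homogeneous_part q B = B"
  shows "supercommutator A B = A ** B - matrix_scale (super_sign p q) (B ** A)"
  using bit_exhaust[of p] bit_exhaust[of q] assms
    homogeneous_part_other[OF assms(1), of "p + 1"] homogeneous_part_other[OF assms(2), of "q + 1"]
  by (auto simp: supercommutator_def mat_mult_distribs)

lemma homogeneous_part_mult:
  assumes "homogeneous_part p A = A" "homogeneous_part q B = B"
  shows "homogeneous_part (p + q) (A ** B) = A ** B"
proof -
  have A: "A $ i $ j = (if index_parity i + index_parity j = p then A $ i $ j else 0)" for i j
    by (subst (1) assms(1)[symmetric]) (simp add: homogeneous_part_def)
  have B: "B $ i $ j = (if index_parity i + index_parity j = q then B $ i $ j else 0)" for i j
    by (subst (1) assms(2)[symmetric]) (simp add: homogeneous_part_def)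
  have *: "A $ i $ k * B $ k $ j = 0" if "index_parity i + index_parity j \<noteq> p + q" for i j k
  proof -
    have "index_parity i + index_parity j
      = (index_parity i + index_parity k) + (index_parity k + index_parity j)"
      using bit_exhaust[of "index_parity k"] by (auto simp: add.assoc)
    then show ?thesis
      using A[of i k] B[of k j] that by (auto split: if_splits)
  qed
  show ?thesis
    by (auto simp: vec_eq_iff homogeneous_part_def matrix_matrix_mult_def * intro!: sum.neutral[symmetric])
qed

lemma homogeneous_part_supercommutator:
  assumes "homogeneous_part p A = A" "homogeneous_part q B = B"
  shows "homogeneous_part (p + q) (supercommutator A B) = supercommutator A B"
  using homogeneous_part_mult[OF assms] homogeneous_part_mult[OF assms(2,1)]
  by (simp only: supercommutator_homogeneous[OF assms] diff_conv_add_uminus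
      mat.scale_minus_left[symmetric] homogeneous_part_linear add.commute[of q p])

lemma supercommutator_skew:
  assumes "homogeneous_part p A = A" "homogeneous_part q B = B"
  shows "supercommutator A B = - matrix_scale (super_sign p q) (supercommutator B A)"
  using assms
  by (simp add: supercommutator_homogeneous super_sign_def algebra_simps)

lemma supercommutator_Jacobi:
  assumes "homogeneous_part p A = A" "homogeneous_part q B = B" "homogeneous_part r C = C"
  shows "supercommutator A (supercommutator B C) =
    supercommutator (supercommutator A B) C
    + matrix_scale (super_sign p q) (supercommutator B (supercommutator A C))"
  using bit_exhaust[of p] bit_exhaust[of q] bit_exhaust[of r] assms
    homogeneous_part_supercommutator[OF assms(1,2)] homogeneous_part_supercommutator[OF assms(2,3)]
    homogeneous_part_supercommutator[OF assms(1,3)]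
  by (auto simp: supercommutator_homogeneous mat_mult_distribs super_sign_def matrix_mul_assoc)

lemma osp_brackets:
  "supercommutator osp_F_plus osp_F_plus = (osp_E_plus :: 'k::field^3^3)"
  "supercommutator osp_F_minus osp_F_minus = (osp_E_minus :: 'k^3^3)"
  "supercommutator osp_F_plus osp_F_minus = (osp_H :: 'k^3^3)"
  "supercommutator osp_H osp_E_plus = matrix_scale 4 (osp_E_plus :: 'k^3^3)"
  "supercommutator osp_H osp_E_minus = matrix_scale (-4) (osp_E_minus :: 'k^3^3)"
  "supercommutator osp_E_plus osp_E_minus = matrix_scale (-8) (osp_H :: 'k^3^3)"
  "supercommutator osp_H osp_F_plus = matrix_scale 2 (osp_F_plus :: 'k^3^3)"
  "supercommutator osp_H osp_F_minus = matrix_scale (-2) (osp_F_minus :: 'k^3^3)"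
  "supercommutator osp_E_plus osp_F_plus = (0 :: 'k^3^3)"
  "supercommutator osp_E_plus osp_F_minus = matrix_scale (-4) (osp_F_plus :: 'k^3^3)"
  "supercommutator osp_E_minus osp_F_plus = matrix_scale 4 (osp_F_minus :: 'k^3^3)"
  "supercommutator osp_E_minus osp_F_minus = (0 :: 'k^3^3)"
  "supercommutator osp_H osp_H = (0 :: 'k^3^3)"
  "supercommutator osp_E_plus osp_E_plus = (0 :: 'k^3^3)"
  "supercommutator osp_E_minus osp_E_minus = (0 :: 'k^3^3)"
proof -
  have hom: "homogeneous_part 0 (osp_H :: 'k^3^3) = osp_H"
    "homogeneous_part 0 (osp_E_plus :: 'k^3^3) = osp_E_plus"
    "homogeneous_part 0 (osp_E_minus :: 'k^3^3) = osp_E_minus"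
    "homogeneous_part 1 (osp_F_plus :: 'k^3^3) = osp_F_plus"
    "homogeneous_part 1 (osp_F_minus :: 'k^3^3) = osp_F_minus"
    by (simp_all add: osp_basis_in_sl12[unfolded sl12_def mem_Collect_eq])
  have unit_mult: "matrix_unit i j ** matrix_unit k l = (if j = k then matrix_unit i l else (0 :: 'k^3^3))"
    for i j k l
  proof -
    have "(if r = i \<and> m = j then 1 else 0) * (if m = k \<and> c = l then 1 else 0)
      = (if m = j then if r = i \<and> j = k \<and> c = l then 1 else 0 else (0 :: 'k))" for r c m
      by auto
    then show ?thesis
      by (simp add: matrix_matrix_mult_def matrix_unit_def vec_eq_iff)
  qed
  note simps = supercommutator_homogeneous[OF hom(1) hom(1)]
    supercommutator_homogeneous[OF hom(1) hom(2)] supercommutator_homogeneous[OF hom(1) hom(3)]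
    supercommutator_homogeneous[OF hom(1) hom(4)] supercommutator_homogeneous[OF hom(1) hom(5)]
    supercommutator_homogeneous[OF hom(2) hom(2)] supercommutator_homogeneous[OF hom(2) hom(3)]
    supercommutator_homogeneous[OF hom(2) hom(4)] supercommutator_homogeneous[OF hom(2) hom(5)]
    supercommutator_homogeneous[OF hom(3) hom(3)] supercommutator_homogeneous[OF hom(3) hom(4)]
    supercommutator_homogeneous[OF hom(3) hom(5)] supercommutator_homogeneous[OF hom(4) hom(4)]
    supercommutator_homogeneous[OF hom(4) hom(5)] supercommutator_homogeneous[OF hom(5) hom(5)]
  show "supercommutator osp_F_plus osp_F_plus = (osp_E_plus :: 'k::field^3^3)"
    by (simp only: simps)
      (simp add: osp_basis_defs mat_mult_distribs unit_mult,
        (simp add: vec_eq_iff matrix_scale_def matrix_unit_def super_sign_def)?)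
  show "supercommutator osp_F_minus osp_F_minus = (osp_E_minus :: 'k^3^3)"
    by (simp only: simps)
      (simp add: osp_basis_defs mat_mult_distribs unit_mult,
        (simp add: vec_eq_iff matrix_scale_def matrix_unit_def super_sign_def)?)
  show "supercommutator osp_F_plus osp_F_minus = (osp_H :: 'k^3^3)"
    by (simp only: simps)
      (simp add: osp_basis_defs mat_mult_distribs unit_mult,
        (simp add: vec_eq_iff matrix_scale_def matrix_unit_def super_sign_def)?)
  show "supercommutator osp_H osp_E_plus = matrix_scale 4 (osp_E_plus :: 'k^3^3)"
    by (simp only: simps)
      (simp add: osp_basis_defs mat_mult_distribs unit_mult,
        (simp add: vec_eq_iff matrix_scale_def matrix_unit_def super_sign_def)?)
  show "supercommutator osp_H osp_E_minus = matrix_scale (-4) (osp_E_minus :: 'k^3^3)"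
    by (simp only: simps)
      (simp add: osp_basis_defs mat_mult_distribs unit_mult,
        (simp add: vec_eq_iff matrix_scale_def matrix_unit_def super_sign_def)?)
  show "supercommutator osp_E_plus osp_E_minus = matrix_scale (-8) (osp_H :: 'k^3^3)"
    by (simp only: simps)
      (simp add: osp_basis_defs mat_mult_distribs unit_mult,
        (simp add: vec_eq_iff matrix_scale_def matrix_unit_def super_sign_def)?)
  show "supercommutator osp_H osp_F_plus = matrix_scale 2 (osp_F_plus :: 'k^3^3)"
    by (simp only: simps)
      (simp add: osp_basis_defs mat_mult_distribs unit_mult,
        (simp add: vec_eq_iff matrix_scale_def matrix_unit_def super_sign_def)?)
  show "supercommutator osp_H osp_F_minus = matrix_scale (-2) (osp_F_minus :: 'k^3^3)"
    by (simp only: simps)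
      (simp add: osp_basis_defs mat_mult_distribs unit_mult,
        (simp add: vec_eq_iff matrix_scale_def matrix_unit_def super_sign_def)?)
  show "supercommutator osp_E_plus osp_F_plus = (0 :: 'k^3^3)"
    by (simp only: simps)
      (simp add: osp_basis_defs mat_mult_distribs unit_mult,
        (simp add: vec_eq_iff matrix_scale_def matrix_unit_def super_sign_def)?)
  show "supercommutator osp_E_plus osp_F_minus = matrix_scale (-4) (osp_F_plus :: 'k^3^3)"
    by (simp only: simps)
      (simp add: osp_basis_defs mat_mult_distribs unit_mult,
        (simp add: vec_eq_iff matrix_scale_def matrix_unit_def super_sign_def)?)
  show "supercommutator osp_E_minus osp_F_plus = matrix_scale 4 (osp_F_minus :: 'k^3^3)"
    by (simp only: simps)
      (simp add: osp_basis_defs mat_mult_distribs unit_mult,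
        (simp add: vec_eq_iff matrix_scale_def matrix_unit_def super_sign_def)?)
  show "supercommutator osp_E_minus osp_F_minus = (0 :: 'k^3^3)"
    by (simp only: simps)
      (simp add: osp_basis_defs mat_mult_distribs unit_mult,
        (simp add: vec_eq_iff matrix_scale_def matrix_unit_def super_sign_def)?)
  show "supercommutator osp_H osp_H = (0 :: 'k^3^3)"
    by (simp only: simps)
      (simp add: osp_basis_defs mat_mult_distribs unit_mult,
        (simp add: vec_eq_iff matrix_scale_def matrix_unit_def super_sign_def)?)
  show "supercommutator osp_E_plus osp_E_plus = (0 :: 'k^3^3)"
    by (simp only: simps)
      (simp add: osp_basis_defs mat_mult_distribs unit_mult,
        (simp add: vec_eq_iff matrix_scale_def matrix_unit_def super_sign_def)?)
  show "supercommutator osp_E_minus osp_E_minus = (0 :: 'k^3^3)"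
    by (simp only: simps)
      (simp add: osp_basis_defs mat_mult_distribs unit_mult,
        (simp add: vec_eq_iff matrix_scale_def matrix_unit_def super_sign_def)?)
qed

lemma osp12_bracket_in:
  assumes "x \<in> osp12 i" "y \<in> osp12 j"
  shows "supercommutator x y \<in> osp12 (i + j)"
proof -
  have sub: "mat.subspace (osp12 p)" for p :: bit
    by (simp add: osp12_def)
  define B :: "bit \<Rightarrow> ('a^3^3) set" where
    "B p = (if p = 0 then {osp_H, osp_E_plus, osp_E_minus} else {osp_F_plus, osp_F_minus})" for p
  have span_B: "osp12 p = mat.span (B p)" for p
    by (simp add: osp12_def B_def)
  have mem: "osp_H \<in> osp12 0" "osp_E_plus \<in> osp12 0" "osp_E_minus \<in> osp12 0"
    "osp_F_plus \<in> osp12 1" "osp_F_minus \<in> osp12 1"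
    by (auto simp: osp12_def intro: mat.span_base)
  have hom: "homogeneous_part p A = A" if "A \<in> osp12 p" for p and A :: "'a^3^3"
    using osp12_subset_sl12[of p] that by (auto simp: sl12_def)
  note closed = mat.subspace_scale[OF sub] mat.subspace_0[OF sub] mat.subspace_neg[OF sub]
  have flip: "supercommutator b a \<in> osp12 r"
    if "supercommutator a b \<in> osp12 r" "a \<in> osp12 p" "b \<in> osp12 q" for a b :: "'a^3^3" and p q r
    unfolding supercommutator_skew[OF hom[OF that(3)] hom[OF that(2)]]
    by (intro mat.subspace_neg[OF sub] mat.subspace_scale[OF sub] that(1))
  have "supercommutator a b \<in> osp12 (p + q)" if "a \<in> B p" "b \<in> B q" for a b p q
  proof -
    have half: "supercommutator a b \<in> osp12 (p + q) \<or> supercommutator b a \<in> osp12 (q + p)"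
      using that bit_exhaust[of p] bit_exhaust[of q]
      by (auto simp: B_def osp_brackets mem closed)
    have "a \<in> osp12 p" "b \<in> osp12 q"
      using that by (auto simp: span_B intro: mat.span_base)
    then show ?thesis
      using half flip[of b a _ q p] by (auto simp only: add.commute[of q p])
  qed
  note BB = this
  have sub_right: "mat.subspace {y. supercommutator a y \<in> osp12 r}" for a :: "'a^3^3" and r
    using supercommutator_bilinear(4)[of a 0 0]
    by (auto simp: mat.subspace_def supercommutator_bilinear
        intro: mat.subspace_add[OF sub] mat.subspace_scale[OF sub] mat.subspace_0[OF sub])
  have sub_left: "mat.subspace {x. supercommutator x y \<in> osp12 r}" for y :: "'a^3^3" and r
    using supercommutator_bilinear(3)[of 0 0 y]
    by (auto simp: mat.subspace_def supercommutator_bilinear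
        intro: mat.subspace_add[OF sub] mat.subspace_scale[OF sub] mat.subspace_0[OF sub])
  have "osp12 j \<subseteq> {y. supercommutator a y \<in> osp12 (i + j)}" if "a \<in> B i" for a
    unfolding span_B[of j] by (rule mat.span_minimal[OF _ sub_right]) (use BB[OF that] in blast)
  with assms(2) have BR: "supercommutator a y \<in> osp12 (i + j)" if "a \<in> B i" for a
    using that by blast
  have "osp12 i \<subseteq> {x. supercommutator x y \<in> osp12 (i + j)}"
    unfolding span_B[of i] by (rule mat.span_minimal[OF _ sub_left]) (use BR in blast)
  then show ?thesis
    using assms(1) by auto
qed

text \<open>A check that the structure above is a Lie superalgebra, so that the assumptions
  on modules over it are not contradictory.\<close>

global_interpretation osp12: lie_superalgebra matrix_scale "osp12 :: bit \<Rightarrow> ('k::field^3^3) set" supercommutator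
proof
  have hom: "homogeneous_part p A = A" if "A \<in> osp12 p" for p and A :: "'k^3^3"
    using osp12_subset_sl12[of p] that by (auto simp: sl12_def)
  show "mat.subspace (osp12 i :: ('k^3^3) set)" for i
    by (simp add: osp12_def)
  have "A = 0" if "A \<in> osp12 0" "A \<in> osp12 1" for A :: "'k^3^3"
    using homogeneous_part_other[OF hom[OF that(1)], of 1] hom[OF that(2)] by simp
  then show "osp12 0 \<inter> osp12 1 = {0 :: 'k^3^3}"
    by (auto simp: osp12_def mat.span_zero)
  show "supercommutator x y \<in> osp12 (i + j)" if "x \<in> osp12 i" "y \<in> osp12 j" for x y :: "'k^3^3" and i j
    using osp12_bracket_in that .
  show "supercommutator x y = - matrix_scale (super_sign i j) (supercommutator y x)"
    if "x \<in> osp12 i" "y \<in> osp12 j" for x y :: "'k^3^3" and i j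
    using supercommutator_skew[OF hom[OF that(1)] hom[OF that(2)]] .
  show "supercommutator x (supercommutator y z) = supercommutator (supercommutator x y) z
      + matrix_scale (super_sign i j) (supercommutator y (supercommutator x z))"
    if "x \<in> osp12 i" "y \<in> osp12 j" "z \<in> osp12 k" for x y z :: "'k^3^3" and i j k
    using supercommutator_Jacobi[OF hom[OF that(1)] hom[OF that(2)] hom[OF that(3)]] .
qed (simp_all add: supercommutator_bilinear)

end

theory Submission
  imports Defs
begin

text \<open>
  The odd generators \<open>f\<close>, \<open>g\<close> and \<open>h = f g + g f\<close> determine the action. On a vector \<open>v\<close> with
  \<open>f v = 0\<close> the operator \<open>f\<^sup>2\<^sup>n g\<^sup>2\<^sup>n\<close> is a nonzero multiple of \<open>\<Prod>j<n. (h - 2 j)\<close>, and the vectors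
  \<open>g\<^sup>2\<^sup>n v\<close> are linearly dependent; hence, without extending the field, \<open>h\<close> is diagonalizable on the kernel of \<open>f\<close>,
  with eigenvalues among \<open>0, 2, 4, \<dots>\<close>. A homogeneous eigenvector \<open>b\<close> in this kernel generates an irreducible
  submodule, spanned by its string \<open>g\<^sup>k b\<close>. Let \<open>U\<close> be the sum of these submodules. The weights of
  \<open>U / f U\<close> are nonpositive, whereas a vector \<open>v\<close> outside \<open>U\<close> with \<open>f v \<in> U\<close> has nonnegative
  weights modulo \<open>U\<close>, so \<open>f v\<close> has positive weights and lies in \<open>f U\<close>; then \<open>v\<close> lies in
  \<open>U + ker f = U\<close>. As \<open>f\<close> is nilpotent, \<open>U\<close> is everything.
\<close>

section \<open>Linear operators on vector spaces\<close>

locale linear_operator = vector_space scale + T: Vector_Spaces.linear scale scale T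
  for scale :: "'k::field \<Rightarrow> 'v::ab_group_add \<Rightarrow> 'v" and T :: "'v \<Rightarrow> 'v"
begin

subsection \<open>Products of shifted operators\<close>

text \<open>The value at \<open>v\<close> of the monic polynomial in \<open>T\<close> whose roots
  are listed in \<open>as\<close>. Lists permit repeated roots and give an induction on the
  factors.\<close>

definition shift_prod :: "'k list \<Rightarrow> 'v \<Rightarrow> 'v" where
  "shift_prod as v = foldr (\<lambda>a w. T w - scale a w) as v"

lemma shift_prod_simps [simp]:
  "shift_prod [] v = v"
  "shift_prod (a # as) v = T (shift_prod as v) - scale a (shift_prod as v)"
  "shift_prod (as @ bs) v = shift_prod as (shift_prod bs v)"
  by (simp_all add: shift_prod_def)

lemma linear_shift_prod: "Vector_Spaces.linear scale scale (shift_prod as)"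
proof -
  have "shift_prod as (v + w) = shift_prod as v + shift_prod as w" for v w
    by (induction as) (simp_all add: T.add algebra_simps)
  moreover have "shift_prod as (scale c v) = scale c (shift_prod as v)" for c v
    by (induction as) (simp_all add: T.scale algebra_simps)
  ultimately show ?thesis
    by (simp add: Vector_Spaces.linear_iff vector_space_axioms)
qed

text \<open>Polynomials in \<open>T\<close> commute, so the outermost factor may be applied
  first.\<close>

lemma shift_prod_commute:
  "shift_prod as (T v - scale b v) = T (shift_prod as v) - scale b (shift_prod as v)"
proof (induction as)
  case (Cons a as)
  show ?case
    unfolding shift_prod_simps Cons.IH by (simp add: T.diff T.scale algebra_simps)
qed simp

lemma shift_prod_in:
  assumes "subspace X" "\<And>x. x \<in> X \<Longrightarrow> T x \<in> X" "v \<in> X"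
  shows "shift_prod as v \<in> X"
  by (induction as) (simp_all add: assms subspace_diff subspace_scale)

lemma shift_prod_eigenvector:
  assumes "T v = scale b v"
  shows "shift_prod as v = scale (\<Prod>a\<leftarrow>as. b - a) v"
  by (induction as) (simp_all add: T.scale assms algebra_simps)

text \<open>On the quotient by \<open>X\<close> the class of \<open>v\<close> is multiplied by
  \<open>b\<close> under \<open>T\<close>, hence by the value at \<open>b\<close> under a polynomial
  in \<open>T\<close>.\<close>

lemma shift_prod_eigenvector_modulo:
  assumes "subspace X" "\<And>x. x \<in> X \<Longrightarrow> T x \<in> X"
    and "T v - scale b v \<in> X"
  shows "shift_prod as v - scale (\<Prod>a\<leftarrow>as. b - a) v \<in> X"
proof (induction as)
  case Nil
  show ?case by (simp add: subspace_0 assms)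
next
  case (Cons a as)
  let ?p = "\<Prod>a\<leftarrow>as. b - a" and ?w = "shift_prod as v"
  let ?d = "?w - scale ?p v"
  \<comment> \<open>The new error is \<open>T - a\<close> applied to the old error
    \<open>?d\<close>, plus \<open>?p\<close> times the error of \<open>v\<close>.\<close>
  have "T ?d - scale a ?d + scale ?p (T v - scale b v) \<in> X"
    by (rule subspace_add[OF assms(1) subspace_diff[OF assms(1) assms(2)[OF Cons]
          subspace_scale[OF assms(1) Cons]] subspace_scale[OF assms(1,3)]])
  also have "T ?d - scale a ?d + scale ?p (T v - scale b v)
      = T ?w - scale a ?w - scale ((b - a) * ?p) v"
    by (simp add: T.diff T.scale algebra_simps)
  finally show ?case by simp
qed

text \<open>Distinct roots in the field give diagonalizability, here for a single vector. A solution
  \<open>w\<close> of \<open>(T - a) w = (T - a) v\<close> among combinations of eigenvectors for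
  the other roots leaves \<open>v - w\<close>, which is killed by \<open>T - a\<close>. The subspace
  \<open>Z\<close> passes its properties on to the eigenvectors.\<close>

lemma killed_by_shift_prod_in_span:
  assumes Z: "subspace Z" "\<And>x. x \<in> Z \<Longrightarrow> T x \<in> Z"
    and "distinct as" "v \<in> Z" "shift_prod as v = 0"
  shows "v \<in> span {e \<in> Z. \<exists>a\<in>set as. T e = scale a e}"
  using assms(3-)
proof (induction as arbitrary: v)
  case Nil
  then show ?case by (simp add: span_zero)
next
  case (Cons a as)
  let ?E = "{e \<in> Z. \<exists>a\<in>set as. T e = scale a e}"
    and ?E' = "{e \<in> Z. \<exists>a\<in>set (a # as). T e = scale a e}"
  have sub: "span ?E \<subseteq> span ?E'"
    by (rule span_mono) auto
  have "T v - scale a v \<in> span ?E"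
    using Cons.prems Cons.IH[of "T v - scale a v"]
    by (simp add: shift_prod_commute Z subspace_diff subspace_scale)
  \<comment> \<open>\<open>T - a\<close> multiplies an eigenvector for \<open>b\<close> by
    \<open>b - a\<close>, which is nonzero because the roots are distinct.\<close>
  moreover have "span ?E \<subseteq> (\<lambda>w. T w - scale a w) ` span ?E"
  proof (rule span_minimal)
    show "?E \<subseteq> (\<lambda>w. T w - scale a w) ` span ?E"
    proof
      fix e assume e: "e \<in> ?E"
      then obtain b where b: "b \<in> set as" "T e = scale b e" by auto
      with Cons.prems have "b - a \<noteq> 0" by auto
      define c where "c = 1 / (b - a)"
      have "T (scale c e) - scale a (scale c e) = scale ((b - a) * c) e"
        by (simp add: T.scale b(2) algebra_simps)
      also have "(b - a) * c = 1"
        using \<open>b - a \<noteq> 0\<close> by (simp add: c_def)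
      finally have "e = T (scale c e) - scale a (scale c e)"
        by simp
      then show "e \<in> (\<lambda>w. T w - scale a w) ` span ?E"
        by (rule image_eqI) (intro span_scale span_base e)
    qed
    interpret D: Vector_Spaces.linear scale scale "\<lambda>w. T w - scale a w"
      using linear_shift_prod[of "[a]"] by (simp add: shift_prod_def[abs_def])
    show "subspace ((\<lambda>w. T w - scale a w) ` span ?E)"
      by (intro D.subspace_image subspace_span)
  qed
  ultimately obtain w where w: "w \<in> span ?E" "T v - scale a v = T w - scale a w"
    by auto
  have "span ?E \<subseteq> Z"
    by (rule span_minimal) (auto simp: Z)
  then have "v - w \<in> ?E'"
    using w Cons.prems by (auto simp: Z subspace_diff T.diff algebra_simps)
  then have "v - w + w \<in> span ?E'"
    using w(1) sub by (blast intro: span_add span_base)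
  then show ?case by simp
qed

text \<open>On the quotient by \<open>X\<close>, the operator \<open>T\<close> is diagonalizable without the eigenvalue \<open>\<alpha>\<close>.\<close>

lemma not_eigenvalue_modulo:
  assumes X: "subspace X" "\<And>x. x \<in> X \<Longrightarrow> T x \<in> X"
    and E: "\<And>e. e \<in> E \<Longrightarrow> e \<in> X \<or> (\<exists>\<beta>. \<beta> \<noteq> \<alpha> \<and> T e = scale \<beta> e)"
    and y: "y \<in> span E" "T y - scale \<alpha> y \<in> X"
  shows "y \<in> X"
proof -
  \<comment> \<open>One factor is collected for each term of a linear combination representing
    \<open>y\<close>; no factor has the root \<alpha>.\<close>
  have "\<exists>bs. \<alpha> \<notin> set bs \<and> shift_prod bs y \<in> X"
    using y(1)
  proof (induction rule: span_induct_alt)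
    case base
    show ?case by (intro exI[of _ "[]"]) (simp add: X subspace_0)
  next
    case (step c e y)
    then obtain bs where bs: "\<alpha> \<notin> set bs" "shift_prod bs y \<in> X" by auto
    interpret P: Vector_Spaces.linear scale scale "shift_prod as" for as
      by (rule linear_shift_prod)
    \<comment> \<open>Modulo \<open>X\<close> an element of \<open>X\<close> is zero and satisfies
      the eigenvalue equation for every scalar; \<alpha> + 1 is one that differs from
      \<alpha>.\<close>
    obtain b where b: "b \<noteq> \<alpha>" "T e - scale b e \<in> X"
    proof (cases "e \<in> X")
      case True
      then have "T e - scale (\<alpha> + 1) e \<in> X"
        by (simp add: X subspace_diff subspace_scale)
      then show ?thesis using that[of "\<alpha> + 1"] by simp
    next
      case False
      then obtain \<beta> where "\<beta> \<noteq> \<alpha>" "T e = scale \<beta> e"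
        using E[OF step(1)] by auto
      then show ?thesis using that[of \<beta>] by (simp add: X subspace_0)
    qed
    have "shift_prod bs (T e - scale b e) \<in> X"
      by (intro shift_prod_in X b)
    then have "shift_prod (b # bs) e \<in> X"
      by (simp add: shift_prod_commute)
    moreover have "shift_prod (b # bs) y \<in> X"
      using bs by (simp add: X subspace_diff subspace_scale)
    ultimately have "shift_prod (b # bs) (scale c e + y) \<in> X"
      unfolding P.add P.scale by (intro subspace_add subspace_scale X)
    then show ?case
      using b bs by (intro exI[of _ "b # bs"]) (auto simp del: shift_prod_simps)
  qed
  then obtain bs where bs: "\<alpha> \<notin> set bs" "shift_prod bs y \<in> X" by auto
  define p where "p = (\<Prod>b\<leftarrow>bs. \<alpha> - b)"
  have "p \<noteq> 0"
    using bs(1) by (auto simp: p_def prod_list_zero_iff)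
  \<comment> \<open>Modulo \<open>X\<close> the polynomial multiplies \<open>y\<close> by its value
    \<open>p\<close> at \<alpha>, so the multiple of \<open>y\<close> by \<open>p\<close> lies in
    \<open>X\<close>.\<close>
  have "shift_prod bs y - (shift_prod bs y - scale p y) \<in> X"
    unfolding p_def
    by (rule subspace_diff[OF X(1) bs(2) shift_prod_eigenvector_modulo[OF X y(2)]])
  then have "scale (1 / p) (scale p y) \<in> X"
    using subspace_scale[OF X(1), of "scale p y" "1 / p"] by simp
  then show ?thesis
    using \<open>p \<noteq> 0\<close> by simp
qed

subsection \<open>The trace relative to a finite independent set\<close>

text \<open>Both sides are traces on \<open>span B\<close>; in matrix coefficients they are the same
  double sum with the order of summation exchanged.\<close>

lemma trace_commute:
  assumes B: "finite B" "independent B" and S: "Vector_Spaces.linear scale scale S"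
    and SB: "S ` B \<subseteq> span B" and TB: "T ` B \<subseteq> span B"
  shows "(\<Sum>b\<in>B. representation B (S (T b)) b) = (\<Sum>b\<in>B. representation B (T (S b)) b)"
proof -
  have expand: "representation B (P (Q b)) b
      = (\<Sum>c\<in>B. representation B (Q b) c * representation B (P c) b)"
    if P: "Vector_Spaces.linear scale scale P" "P ` B \<subseteq> span B" and Q: "Q ` B \<subseteq> span B"
      and b: "b \<in> B" for P Q :: "'v \<Rightarrow> 'v" and b
  proof -
    interpret P: Vector_Spaces.linear scale scale P by (rule P)
    have "Q b = (\<Sum>c\<in>B. scale (representation B (Q b) c) c)"
      using B Q b by (subst sum_representation_eq) auto
    then have "P (Q b) = P (\<Sum>c\<in>B. scale (representation B (Q b) c) c)"
      by (rule arg_cong)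
    also have "\<dots> = (\<Sum>c\<in>B. scale (representation B (Q b) c) (P c))"
      by (simp add: P.sum P.scale)
    finally have "representation B (P (Q b)) b
        = representation B (\<Sum>c\<in>B. scale (representation B (Q b) c) (P c)) b"
      by simp
    also have "\<dots> = (\<Sum>c\<in>B. representation B (scale (representation B (Q b) c) (P c)) b)"
      using B P by (subst representation_sum) (auto intro!: span_scale)
    also have "\<dots> = (\<Sum>c\<in>B. representation B (Q b) c * representation B (P c) b)"
      using B P by (intro sum.cong refl) (subst representation_scale, auto)
    finally show ?thesis .
  qed
  have "(\<Sum>b\<in>B. representation B (S (T b)) b)
      = (\<Sum>b\<in>B. \<Sum>c\<in>B. representation B (T b) c * representation B (S c) b)"
    by (intro sum.cong refl expand S SB TB)
  also have "\<dots> = (\<Sum>c\<in>B. \<Sum>b\<in>B. representation B (S c) b * representation B (T b) c)"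
    by (subst sum.swap) (simp add: mult.commute)
  also have "\<dots> = (\<Sum>b\<in>B. representation B (T (S b)) b)"
    by (intro sum.cong refl expand[symmetric] T.linear_axioms SB TB)
  finally show ?thesis .
qed

end

subsection \<open>Raising operators are nilpotent\<close>

context finite_dimensional_vector_space
begin

text \<open>Otherwise every initial segment of the sequence would be independent, including one
  longer than the dimension.\<close>

lemma ex_in_span_previous: "\<exists>n. x n \<in> span (x ` {..<n})" for x :: "nat \<Rightarrow> 'b"
proof (rule ccontr)
  assume *: "\<nexists>n. x n \<in> span (x ` {..<n})"
  have "independent (x ` {..<n}) \<and> card (x ` {..<n}) = n" for n
  proof (induction n)
    case 0
    show ?case by (simp add: independent_empty)
  next
    case (Suc n)
    moreover have "x n \<notin> span (x ` {..<n})" using * by auto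
    moreover have "x n \<notin> x ` {..<n}" using * span_base[of "x n" "x ` {..<n}"] by blast
    ultimately show ?case
      by (simp add: lessThan_Suc independent_insertI)
  qed
  from this[of "Suc dimension"] show False
    using independent_card_le_dim[of "x ` {..<Suc dimension}" UNIV]
    by (simp add: dimension_def)
qed

text \<open>The image of a basis of \<open>X\<close> spans \<open>X\<close> and has no more elements
  than the basis, so it is again a basis.\<close>

lemma inj_on_if_surj_on_subspace:
  assumes "Vector_Spaces.linear scale scale f" "subspace X" "f ` X = X"
  shows "inj_on f X"
proof -
  interpret f: Vector_Spaces.linear scale scale f by fact
  obtain B where B: "B \<subseteq> X" "independent B" "X \<subseteq> span B" "card B = dim X"
    using basis_exists by blast
  have sB: "span B = X" using B assms(2) by (intro span_subspace) auto
  have fin: "finite B" using B(2) by (rule finiteI_independent)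
  have spf: "X \<subseteq> span (f ` B)"
    using f.span_image[of B] assms(3) by (simp add: sB)
  have "dim X \<le> card (f ` B)"
    using dim_le_card[OF spf] fin by simp
  then have card: "card (f ` B) = card B"
    using card_image_le[OF fin, of f] B(4) by simp
  have "independent (f ` B)"
    by (rule card_le_dim_spanning[OF _ spf]) (use B assms fin card in auto)
  moreover have "inj_on f B"
    using card fin by (simp add: eq_card_imp_inj_on)
  ultimately show ?thesis
    using f.inj_on_span_iff_independent_image[of B] sB by simp
qed

end

text \<open>If \<open>f\<close> were bijective on a nonzero \<open>h\<close>-stable subspace, then \<open>h\<close> and its conjugate
  \<open>f\<^sup>-\<^sup>1 h f = h + c\<close> would have the same trace there.\<close>

lemma (in finite_dimensional_vector_space) raising_operator_nilpotent:
  fixes f h :: "'b \<Rightarrow> 'b" and c :: 'a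
  assumes char: "\<And>n. n > 0 \<Longrightarrow> (of_nat n :: 'a) \<noteq> 0"
    and f: "Vector_Spaces.linear scale scale f" and h: "Vector_Spaces.linear scale scale h"
    and comm: "\<And>v. h (f v) = f (h v) + scale c (f v)" and c: "c \<noteq> 0"
  shows "\<exists>n. \<forall>v. (f ^^ n) v = 0"
proof -
  interpret f: Vector_Spaces.linear scale scale f by fact
  interpret h: Vector_Spaces.linear scale scale h by fact
  define X where "X n = range (f ^^ n)" for n
  have X_Suc: "X (Suc n) = f ` X n" for n
    by (auto simp: X_def)
  have subX: "subspace (X n)" for n
    by (induction n) (simp_all add: X_Suc f.subspace_image, simp add: X_def)
  have decX: "X (Suc n) \<subseteq> X n" for n
    by (induction n) (auto simp: X_Suc, simp add: X_def)
  have hX: "h x \<in> X n" if "x \<in> X n" for n x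
    using that
  proof (induction n arbitrary: x)
    case 0
    show ?case by (simp add: X_def)
  next
    case (Suc n)
    then obtain y where y: "y \<in> X n" "x = f y" by (auto simp: X_Suc)
    have "h x = f (h y + scale c y)" by (simp add: y comm f.add f.scale)
    moreover have "h y + scale c y \<in> X n"
      using Suc.IH[OF y(1)] y(1) subX by (simp add: subspace_add subspace_scale)
    ultimately show ?case by (simp add: X_Suc)
  qed
  \<comment> \<open>The ranges of the powers decrease, so one of least dimension is mapped onto
    itself by \<open>f\<close>.\<close>
  obtain n where n: "\<And>m. dim (X n) \<le> dim (X m)"
    using ex_has_least_nat[of "\<lambda>_. True" 0 "\<lambda>n. dim (X n)"] by auto
  define Y where "Y = X n"
  have Y: "subspace Y" by (simp add: Y_def subX)
  have fY: "f ` Y = Y"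
    using subspace_dim_equal[OF subX[of "Suc n"] subX[of n] decX n] by (simp add: Y_def X_Suc)
  have fY': "f x \<in> Y" if "x \<in> Y" for x
    using imageI[OF that, of f] by (simp only: fY)
  have hY: "h x \<in> Y" if "x \<in> Y" for x
    using hX that by (simp add: Y_def)
  interpret vp: vector_space_pair scale scale ..
  \<comment> \<open>The inverse of \<open>f\<close> on \<open>Y\<close> is extended to a linear map
    on the whole space with values in \<open>Y\<close>, so that \<open>trace_commute\<close> applies
    to it.\<close>
  from vp.linear_exists_left_inverse_on[OF f Y inj_on_if_surj_on_subspace[OF f Y fY]]
  obtain s where s: "range s \<subseteq> Y" "Vector_Spaces.linear scale scale s" "\<forall>v\<in>Y. s (f v) = v"
    by (elim exE conjE)
  interpret s: linear_operator scale s
    by (intro linear_operator.intro vector_space_axioms s(2))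
  have fs: "f (s v) = v" if "v \<in> Y" for v
  proof -
    have "v \<in> f ` Y" using that fY by simp
    then obtain w where "w \<in> Y" "v = f w" by (rule imageE)
    then show ?thesis by (simp add: s)
  qed
  obtain B where B: "B \<subseteq> Y" "independent B" "Y \<subseteq> span B" "card B = dim Y"
    using basis_exists by blast
  have sB: "span B = Y" using B Y by (intro span_subspace) auto
  have fin: "finite B" using B(2) by (rule finiteI_independent)
  have BY: "b \<in> Y" if "b \<in> B" for b using that B(1) by blast
  \<comment> \<open>On \<open>Y\<close>: tr h = tr (h f s) = tr (s h f) = tr (h + c), so
    \<open>c\<close> times the dimension of \<open>Y\<close> is zero.\<close>
  have "(\<Sum>b\<in>B. representation B (h b) b) = (\<Sum>b\<in>B. representation B ((h \<circ> f) (s b)) b)"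
    using BY by (intro sum.cong) (simp_all add: fs)
  also have "\<dots> = (\<Sum>b\<in>B. representation B (s ((h \<circ> f) b)) b)"
  proof (rule s.trace_commute[OF fin B(2)])
    show "Vector_Spaces.linear scale scale (h \<circ> f)"
      using f h by (rule Vector_Spaces.linear_compose)
    show "(h \<circ> f) ` B \<subseteq> span B" unfolding sB by (auto intro: hY fY' BY)
    show "s ` B \<subseteq> span B" unfolding sB using s(1) by blast
  qed
  also have "\<dots> = (\<Sum>b\<in>B. representation B (h b) b + c)"
  proof (rule sum.cong)
    fix b assume b: "b \<in> B"
    then have "b \<in> Y" "h b \<in> Y" using BY hY by auto
    then have "s ((h \<circ> f) b) = h b + scale c b"
      using s by (simp add: comm s.T.add s.T.scale)
    then show "representation B (s ((h \<circ> f) b)) b = representation B (h b) b + c"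
      using B(2) b \<open>h b \<in> Y\<close>
      by (simp add: representation_add representation_scale representation_basis sB span_base
          span_scale BY subspace_scale Y)
  qed simp
  also have "\<dots> = (\<Sum>b\<in>B. representation B (h b) b) + of_nat (card B) * c"
    by (simp add: sum.distrib)
  finally have "card B = 0"
    using c char[of "card B"] by auto
  then have "Y = {0}"
    using sB fin by auto
  then show ?thesis
    by (auto simp: Y_def X_def)
qed

section \<open>Finite-dimensional modules in terms of the odd generators\<close>

text \<open>\<open>f\<close>, \<open>g\<close>, \<open>h\<close> stand for the actions of
  \<open>osp_F_plus\<close>, \<open>osp_F_minus\<close>, \<open>osp_H\<close>. The three equations
  are the brackets [F+, F-] = H, [H, F+] = 2 F+ and [H, F-] = -2 F-. The other even basis elements
  act as 2 f^2 and 2 g^2.\<close>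

locale osp_operators =
  linear_operator scale h + finite_dimensional_vector_space scale Basis +
  f: Vector_Spaces.linear scale scale f + g: Vector_Spaces.linear scale scale g
  for scale :: "'k::field_char_0 \<Rightarrow> 'v::ab_group_add \<Rightarrow> 'v" and Basis :: "'v set"
    and f g h :: "'v \<Rightarrow> 'v" +
  assumes h_eq: "h v = f (g v) + g (f v)"
    and h_f: "h (f v) = f (h v) + scale 2 (f v)"
    and h_g: "h (g v) = g (h v) - scale 2 (g v)"
begin

section \<open>Powers of the generators and invariant subspaces\<close>

lemma linear_funpow:
  assumes "Vector_Spaces.linear scale scale p"
  shows "Vector_Spaces.linear scale scale (p ^^ n)"
proof (induction n)
  case 0
  show ?case using linear_id by (simp add: id_def)
next
  case (Suc n)
  show ?case
    unfolding funpow.simps by (rule Vector_Spaces.linear_compose[OF Suc assms])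
qed

interpretation fp: Vector_Spaces.linear scale scale "f ^^ n" for n
  by (rule linear_funpow) (rule f.linear_axioms)

interpretation gp: Vector_Spaces.linear scale scale "g ^^ n" for n
  by (rule linear_funpow) (rule g.linear_axioms)

lemma h_g_power: "h ((g ^^ k) v) = (g ^^ k) (h v) - scale (of_nat (2 * k)) ((g ^^ k) v)"
proof (induction k)
  case (Suc k)
  show ?case
    by (simp add: h_g Suc g.diff g.scale algebra_simps)
qed simp

lemma f_g_power_Suc: "f ((g ^^ Suc k) v) = h ((g ^^ k) v) - g (f ((g ^^ k) v))"
  by (simp add: h_eq)

text \<open>The submodules without regard to the grading; stability under \<open>h\<close> follows
  from \<open>h_eq\<close>.\<close>

definition invariant :: "'v set \<Rightarrow> bool" where
  "invariant U \<longleftrightarrow> subspace U \<and> (\<forall>u\<in>U. f u \<in> U \<and> g u \<in> U)"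

lemma invariantD:
  assumes "invariant U"
  shows "subspace U" "u \<in> U \<Longrightarrow> f u \<in> U" "u \<in> U \<Longrightarrow> g u \<in> U" "u \<in> U \<Longrightarrow> h u \<in> U"
    "u \<in> U \<Longrightarrow> (f ^^ n) u \<in> U"
  using assms by (auto simp: invariant_def h_eq subspace_add) (induction n, auto)

text \<open>With \<open>{0}\<close> for \<open>U\<close>, statements modulo \<open>U\<close> become
  statements about the vectors themselves.\<close>

lemma invariant_0: "invariant {0}"
  by (simp add: invariant_def f.zero g.zero)

lemma invariant_span:
  assumes "\<And>w. w \<in> A \<Longrightarrow> f w \<in> span A \<and> g w \<in> span A"
  shows "invariant (span A)"
proof -
  have "span A \<subseteq> {w. f w \<in> span A}" "span A \<subseteq> {w. g w \<in> span A}"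
    using assms
    by (intro span_minimal f.subspace_linear_preimage g.subspace_linear_preimage subspace_span; blast)+
  then show ?thesis by (auto simp: invariant_def)
qed

subsection \<open>Vectors annihilated by the raising operator modulo an invariant subspace\<close>

text \<open>Each relation yields the next through \<open>f g^(k+1) = h g^k - g f g^k\<close>, where
  \<open>h\<close> contributes the shift \<open>-2 k\<close>. The parity of the exponent decides
  whether \<open>h\<close> survives on the right.\<close>

lemma f_g_power_modulo:
  assumes U: "invariant U" and v: "f v \<in> U"
  shows "f ((g ^^ (2 * j + 1)) v) - (g ^^ (2 * j)) (h v) + scale (of_nat (2 * j)) ((g ^^ (2 * j)) v) \<in> U"
      (is "?odd j")
    and "f ((g ^^ (2 * j + 2)) v) + scale (of_nat (2 * j + 2)) ((g ^^ (2 * j + 1)) v) \<in> U"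
      (is "?even j")
proof -
  have double: "scale (c * 4) w = scale (c * 2) w + scale (c * 2) w" for c w
    by (simp flip: scale_left_distrib)
  note neg = subspace_neg[OF invariantD(1)[OF U] invariantD(3)[OF U]]
  have even: "?even j" if "?odd j" for j
  proof -
    have "f ((g ^^ Suc (2 * j + 1)) v) + scale (of_nat (2 * j + 2)) ((g ^^ (2 * j + 1)) v)
      = - g (f ((g ^^ (2 * j + 1)) v) - (g ^^ (2 * j)) (h v) + scale (of_nat (2 * j)) ((g ^^ (2 * j)) v))"
      unfolding f_g_power_Suc h_g_power by (simp add: g.diff g.add g.scale double double[of 1, simplified]
          algebra_simps)
    then show ?thesis using neg[OF that] by simp
  qed
  have odd: "?odd (Suc j)" if "?even j" for j
  proof -
    have "f ((g ^^ Suc (2 * j + 2)) v) - (g ^^ (2 * j + 2)) (h v)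
        + scale (of_nat (2 * j + 2)) ((g ^^ (2 * j + 2)) v)
      = - g (f ((g ^^ (2 * j + 2)) v) + scale (of_nat (2 * j + 2)) ((g ^^ (2 * j + 1)) v))"
      unfolding f_g_power_Suc[of "2 * j + 2"] h_g_power
      by (simp add: g.diff g.add g.scale double double[of 1, simplified]
          algebra_simps)
    then show ?thesis using neg[OF that] by simp
  qed
  have "?odd 0"
    using neg[OF v] by (simp add: h_eq)
  then show "?odd j"
    by (induction j) (use odd even in blast)+
  then show "?even j"
    by (rule even)
qed

text \<open>Since \<open>f h = (h - 2) f\<close>, the vectors sent into \<open>U\<close> by
  \<open>f\<close> are stable under \<open>h\<close> and its shifts.\<close>

lemma f_h_modulo:
  assumes "invariant U" "f v \<in> U"
  shows "f (h v - scale c v) \<in> U"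
proof -
  have "f (h v - scale c v) = h (f v) - scale (2 + c) (f v)"
    by (simp add: h_f f.diff f.scale algebra_simps)
  then show ?thesis
    using assms by (simp add: invariantD subspace_diff subspace_scale)
qed

text \<open>\<open>f\<close> cancels one \<open>g\<close> at the cost of replacing \<open>v\<close>
  by \<open>w\<close>, which is \<open>(h - k) v\<close> for even \<open>k\<close> and
  \<open>-(k + 1) v\<close> for odd \<open>k\<close>. This form treats both parities alike.\<close>

lemma f_g_power_modulo':
  assumes "invariant U" "f v \<in> U"
  shows "\<exists>w. f w \<in> U \<and> f ((g ^^ Suc k) v) - (g ^^ k) w \<in> U"
proof (cases "even k")
  case True
  then obtain j where k: "k = 2 * j" by auto
  show ?thesis
    using f_g_power_modulo(1)[OF assms, of j] f_h_modulo[OF assms]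
    by (intro exI[of _ "h v - scale (of_nat k) v"])
      (simp add: k gp.diff gp.scale algebra_simps)
next
  case False
  then obtain j where k: "k = 2 * j + 1" by (auto elim: oddE)
  define d :: 'k where "d = of_nat (2 * j + 2)"
  have "f (scale (- d) v) \<in> U"
    unfolding f.scale by (intro subspace_scale invariantD(1) assms)
  moreover have "f ((g ^^ Suc k) v) - (g ^^ k) (scale (- d) v) \<in> U"
    using f_g_power_modulo(2)[OF assms, of j, folded d_def] by (simp add: k gp.scale gp.neg g.neg g.scale)
  ultimately show ?thesis by blast
qed

text \<open>Every \<open>f\<close> cancels one \<open>g\<close>, and a surplus \<open>f\<close>
  meets a vector that it sends into \<open>U\<close>.\<close>

lemma f_power_g_power_in:
  assumes "invariant U" "f v \<in> U" "j < k"
  shows "(f ^^ k) ((g ^^ j) v) \<in> U"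
  using assms(2,3)
proof (induction k arbitrary: v j)
  case (Suc k)
  note f_swap = funpow_Suc_right o_apply
  show ?case
  proof (cases j)
    case 0
    then show ?thesis
      using Suc.prems invariantD(5)[OF assms(1)] by (simp add: f_swap del: funpow.simps)
  next
    case (Suc i)
    obtain w where w: "f w \<in> U" "f ((g ^^ j) v) - (g ^^ i) w \<in> U"
      using f_g_power_modulo'[OF assms(1) Suc.prems(1), of i] Suc by auto
    have "(f ^^ k) (f ((g ^^ j) v) - (g ^^ i) w) + (f ^^ k) ((g ^^ i) w) \<in> U"
      using w Suc Suc.prems
      by (intro subspace_add invariantD(1,5)[OF assms(1)] Suc.IH) auto
    then show ?thesis
      by (simp add: f_swap fp.diff del: funpow.simps)
  qed
qed simp

definition weights :: "nat \<Rightarrow> 'k list" where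
  "weights n = map (\<lambda>j. of_nat (2 * j)) [0..<n]"

text \<open>Two applications of \<open>f\<close> turn \<open>g^(2n+2) v\<close> into
  \<open>-(2n+2) g^(2n) (h - 2n) v\<close> modulo \<open>U\<close>. The scalar \<open>c\<close> is
  chosen before \<open>v\<close>, so the induction hypothesis can be used for
  \<open>(h - 2n) v\<close>.\<close>

lemma f_power_g_power_modulo:
  assumes U: "invariant U"
  shows "\<exists>c. c \<noteq> 0 \<and> (\<forall>v. f v \<in> U \<longrightarrow>
    (f ^^ (2 * n)) ((g ^^ (2 * n)) v) - scale c (shift_prod (weights n) v) \<in> U)"
proof (induction n)
  case 0
  show ?case
    by (intro exI[of _ 1]) (simp add: weights_def subspace_0 invariantD[OF U])
next
  case (Suc n)
  note U' = invariantD[OF U]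
  from Suc obtain c where c: "c \<noteq> 0"
    "\<And>v. f v \<in> U \<Longrightarrow> (f ^^ (2 * n)) ((g ^^ (2 * n)) v) - scale c (shift_prod (weights n) v) \<in> U"
    by auto
  define d :: 'k where "d = of_nat (2 * n + 2)"
  have "d \<noteq> 0"
    unfolding d_def of_nat_eq_0_iff by simp
  have "(f ^^ (2 * Suc n)) ((g ^^ (2 * Suc n)) v)
      - scale (- d * c) (shift_prod (weights (Suc n)) v) \<in> U" if v: "f v \<in> U" for v
  proof -
    define w where "w = h v - scale (of_nat (2 * n)) v"
    define x where "x = (g ^^ (2 * n + 2)) v"
    define y where "y = (g ^^ (2 * n + 1)) v"
    define z where "z = (g ^^ (2 * n)) w"
    have xy: "f x + scale d y \<in> U"
      using f_g_power_modulo(2)[OF U v, of n] by (simp add: x_def y_def d_def)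
    have yz: "f y - z \<in> U"
      using f_g_power_modulo(1)[OF U v, of n]
      by (simp add: y_def z_def w_def gp.diff gp.scale algebra_simps)
    have "f (f x + scale d y) - scale d (f y - z) \<in> U"
      by (intro subspace_diff subspace_scale U' xy yz)
    then have "f (f x) + scale d z \<in> U"
      by (simp add: f.add f.scale algebra_simps)
    then have "(f ^^ (2 * n)) (f (f x) + scale d z) \<in> U"
      by (rule U')
    moreover
    have "(f ^^ (2 * n)) z - scale c (shift_prod (weights n) w) \<in> U"
      unfolding z_def using c(2) f_h_modulo[OF U v] by (simp add: w_def)
    ultimately have "(f ^^ (2 * n)) (f (f x) + scale d z)
        - scale d ((f ^^ (2 * n)) z - scale c (shift_prod (weights n) w)) \<in> U"
      by (rule subspace_diff[OF U'(1) _ subspace_scale[OF U'(1)]])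
    also have "(f ^^ (2 * n)) (f (f x) + scale d z)
        - scale d ((f ^^ (2 * n)) z - scale c (shift_prod (weights n) w))
      = (f ^^ (2 * n)) (f (f x)) - scale (- d * c) (shift_prod (weights n) w)"
      by (simp add: fp.add fp.scale algebra_simps)
    also have "(f ^^ (2 * n)) (f (f x)) = (f ^^ (2 * Suc n)) x"
      by (simp add: funpow_swap1)
    also have "shift_prod (weights n) w = shift_prod (weights (Suc n)) v"
      by (simp add: weights_def w_def)
    finally show ?thesis by (simp add: x_def)
  qed
  moreover have "- d * c \<noteq> 0"
    using \<open>d \<noteq> 0\<close> c by simp
  ultimately show ?case by blast
qed

text \<open>Some \<open>g^(2n) v\<close> is a combination of lower even powers, all of which
  \<open>f^(2n)\<close> sends into \<open>U\<close>. So \<open>f^(2n) g^(2n) v\<close> lies in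
  \<open>U\<close>, and it is a nonzero multiple of the product modulo \<open>U\<close>.\<close>

lemma shift_prod_weights_in:
  assumes U: "invariant U" and v: "f v \<in> U"
  shows "\<exists>n. shift_prod (weights n) v \<in> U"
proof -
  obtain n where n: "(g ^^ (2 * n)) v \<in> span ((\<lambda>k. (g ^^ (2 * k)) v) ` {..<n})"
    using ex_in_span_previous[of "\<lambda>k. (g ^^ (2 * k)) v"] by blast
  have "span ((\<lambda>k. (g ^^ (2 * k)) v) ` {..<n}) \<subseteq> {y. (f ^^ (2 * n)) y \<in> U}"
    by (intro span_minimal fp.subspace_linear_preimage invariantD(1)[OF U])
      (auto intro!: f_power_g_power_in[OF U v])
  with n have top: "(f ^^ (2 * n)) ((g ^^ (2 * n)) v) \<in> U"
    by blast
  obtain c where c: "c \<noteq> 0"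
    "(f ^^ (2 * n)) ((g ^^ (2 * n)) v) - scale c (shift_prod (weights n) v) \<in> U"
    using f_power_g_power_modulo[OF U] v by blast
  have "scale c (shift_prod (weights n) v) \<in> U"
    using subspace_diff[OF invariantD(1)[OF U] top c(2)] by simp
  then have "shift_prod (weights n) v \<in> U"
    using subspace_scale[OF invariantD(1)[OF U], of _ "1 / c"] c(1) by fastforce
  then show ?thesis ..
qed

subsection \<open>The submodule generated by a highest weight vector\<close>

definition string :: "'v \<Rightarrow> 'v set" where
  "string b = span (range (\<lambda>k. (g ^^ k) b))"

lemma string_contains: "(g ^^ k) b \<in> string b"
  by (auto simp: string_def intro: span_base)

context
  fixes b :: 'v and m :: nat
  assumes f_b: "f b = 0" and h_b: "h b = scale (of_nat (2 * m)) b"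
begin

lemma h_string: "h ((g ^^ k) b) = scale (of_nat (2 * m) - of_nat (2 * k)) ((g ^^ k) b)"
  by (simp add: h_g_power h_b gp.scale algebra_simps)

text \<open>The matrix coefficients of \<open>f\<close> on the string. The only zero is at
  \<open>k = 2 * m\<close>, the bottom of the string.\<close>

definition string_coeff :: "nat \<Rightarrow> 'k" where
  "string_coeff k = (if even k then of_nat (2 * m) - of_nat k else - of_nat (k + 1))"

lemma f_string: "f ((g ^^ Suc k) b) = scale (string_coeff k) ((g ^^ k) b)"
proof (cases "even k")
  case True
  then obtain j where "k = 2 * j" by auto
  then show ?thesis
    using f_g_power_modulo(1)[OF invariant_0, of b j] f_b
    by (simp add: string_coeff_def h_b gp.scale algebra_simps)
next
  case False
  then obtain j where "k = 2 * j + 1" by (auto elim: oddE)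
  then show ?thesis
    using f_g_power_modulo(2)[OF invariant_0, of b j] f_b
    by (simp add: string_coeff_def eq_neg_iff_add_eq_0 algebra_simps)
qed

lemma string_coeff_nonzero:
  assumes "k < 2 * m"
  shows "string_coeff k \<noteq> 0"
proof -
  have "(of_nat (2 * m) :: 'k) \<noteq> of_nat k" "(of_nat (k + 1) :: 'k) \<noteq> 0"
    unfolding of_nat_eq_iff of_nat_eq_0_iff using assms by auto
  then show ?thesis
    by (cases "even k") (simp_all only: string_coeff_def if_True if_False right_minus_eq
        neg_equal_0_iff_equal not_False_eq_True)
qed

text \<open>This vector is killed by \<open>f\<close> and has weight \<open>-2m - 2\<close>. Vectors
  killed by \<open>f\<close> are annihilated by a product of factors \<open>h - 2j\<close>, and none
  of these vanishes at a negative weight.\<close>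

lemma string_end: "(g ^^ Suc (2 * m)) b = 0"
proof -
  let ?y = "(g ^^ Suc (2 * m)) b"
  have "f ?y = 0"
    unfolding f_string by (simp add: string_coeff_def)
  then obtain n where n: "shift_prod (weights n) ?y = 0"
    using shift_prod_weights_in[OF invariant_0, of ?y] by auto
  define \<beta> :: 'k where "\<beta> = of_nat (2 * m) - of_nat (2 * Suc (2 * m))"
  have "shift_prod (weights n) ?y = scale (\<Prod>a\<leftarrow>weights n. \<beta> - a) ?y"
    by (rule shift_prod_eigenvector) (simp only: h_string \<beta>_def)
  moreover have "\<beta> - of_nat (2 * j) \<noteq> 0" for j
  proof -
    have "\<beta> - of_nat (2 * j) = - of_nat (2 * m + 2 + 2 * j)"
      by (simp add: \<beta>_def)
    then show ?thesis
      by (metis add_2_eq_Suc' add_Suc neg_equal_0_iff_equal of_nat_eq_0_iff nat.distinct(1))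
  qed
  then have "(\<Prod>a\<leftarrow>weights n. \<beta> - a) \<noteq> 0"
    by (auto simp: weights_def prod_list_zero_iff)
  ultimately show ?thesis
    using n by simp
qed

lemma string_vanishes: "k > 2 * m \<Longrightarrow> (g ^^ k) b = 0"
proof (induction k rule: less_induct)
  case (less k)
  show ?case
  proof (cases "k = Suc (2 * m)")
    case True
    then show ?thesis using string_end by simp
  next
    case False
    then have "(g ^^ (k - 1)) b = 0" "k = Suc (k - 1)"
      using less by auto
    then show ?thesis
      by (metis funpow.simps(2) g.zero o_apply)
  qed
qed

lemma invariant_string: "invariant (string b)"
  unfolding string_def
proof (rule invariant_span)
  fix w assume "w \<in> range (\<lambda>k. (g ^^ k) b)"
  then obtain k where w: "w = (g ^^ k) b" by auto
  have "g w \<in> span (range (\<lambda>k. (g ^^ k) b))"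
    unfolding w by (rule span_base, rule range_eqI[of _ _ "Suc k"]) simp
  moreover have "f w \<in> span (range (\<lambda>k. (g ^^ k) b))"
  proof (cases k)
    case 0
    then show ?thesis by (simp add: w f_b span_zero)
  next
    case (Suc i)
    then show ?thesis unfolding w by (simp only: f_string) (intro span_scale span_base rangeI)
  qed
  ultimately show "f w \<in> span (range (\<lambda>k. (g ^^ k) b)) \<and> g w \<in> span (range (\<lambda>k. (g ^^ k) b))"
    by simp
qed

text \<open>The scalar is the product of the coefficients passed on the way up, all nonzero above
  the bottom of the string.\<close>

lemma f_power_string:
  assumes "k \<le> 2 * m"
  shows "\<exists>c. c \<noteq> 0 \<and> (f ^^ k) ((g ^^ k) b) = scale c b"
  using assms
proof (induction k)
  case 0
  show ?case by (intro exI[of _ 1]) simp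
next
  case (Suc k)
  then obtain c where c: "c \<noteq> 0" "(f ^^ k) ((g ^^ k) b) = scale c b" by auto
  have "(f ^^ Suc k) ((g ^^ Suc k) b) = (f ^^ k) (f ((g ^^ Suc k) b))"
    by (simp only: funpow_Suc_right o_apply)
  also have "\<dots> = scale (string_coeff k * c) b"
    by (simp only: f_string fp.scale c scale_scale)
  finally show ?case
    using c string_coeff_nonzero[of k] Suc.prems by (metis Suc_le_lessD mult_eq_0_iff)
qed

text \<open>If \<open>n\<close> is the highest exponent of \<open>g\<close> in a nonzero
  \<open>x\<close> of \<open>X\<close>, then \<open>f^n\<close> kills the lower terms and sends
  \<open>x\<close> to a nonzero multiple of \<open>b\<close>; so \<open>b\<close> and its whole
  string lie in \<open>X\<close>.\<close>

lemma string_irreducible: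
  assumes X: "invariant X" "X \<subseteq> string b" "X \<noteq> {0}"
  shows "X = string b"
proof -
  let ?G = "\<lambda>k. (g ^^ k) b"
  \<comment> \<open>The bound \<open>n\<close> on the exponents is lowered until the leading
    coefficient is nonzero.\<close>
  have b_in: "b \<in> X" if "n \<le> Suc (2 * m)" "x \<in> span (?G ` {..<n})" "x \<noteq> 0" "x \<in> X" for n x
    using that
  proof (induction n)
    case 0
    then show ?case by simp
  next
    case (Suc n)
    obtain a where a: "x - scale a (?G n) \<in> span (?G ` {..<n})"
      using Suc.prems(2) by (auto simp: lessThan_Suc span_breakdown_eq)
    show ?case
    proof (cases "a = 0")
      case True
      then show ?thesis using Suc a by simp
    next
      case False
      have "span (?G ` {..<n}) \<subseteq> {y. (f ^^ n) y \<in> {0}}"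
        by (intro span_minimal fp.subspace_linear_preimage subspace_single_0)
          (use f_power_g_power_in[OF invariant_0, of b _ n] f_b in auto)
      with a have "(f ^^ n) (x - scale a (?G n)) = 0" by blast
      moreover obtain c where c: "c \<noteq> 0" "(f ^^ n) (?G n) = scale c b"
        using f_power_string[of n] Suc.prems(1) by auto
      ultimately have "(f ^^ n) x = scale (a * c) b"
        by (simp add: fp.diff fp.scale)
      moreover have "(f ^^ n) x \<in> X"
        using invariantD(5)[OF X(1)] Suc.prems by simp
      ultimately have "scale (a * c) b \<in> X"
        by (simp only:)
      then have "scale (1 / (a * c)) (scale (a * c) b) \<in> X"
        by (rule subspace_scale[OF invariantD(1)[OF X(1)]])
      then show ?thesis using False c by simp
    qed
  qed
  obtain x where x: "x \<in> X" "x \<noteq> 0"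
    using X subspace_0 invariantD(1) by blast
  have "range ?G \<subseteq> span (?G ` {..<Suc (2 * m)})"
  proof
    fix y assume "y \<in> range ?G"
    then obtain k where "y = ?G k" by auto
    then show "y \<in> span (?G ` {..<Suc (2 * m)})"
      by (cases "k < Suc (2 * m)") (auto intro: span_base simp: string_vanishes span_zero)
  qed
  then have "string b \<subseteq> span (?G ` {..<Suc (2 * m)})"
    unfolding string_def by (rule span_minimal) simp
  then have "b \<in> X"
    using b_in[of "Suc (2 * m)" x] x X(2) by blast
  then have "?G k \<in> X" for k
    using invariantD(3)[OF X(1)] by (induction k) auto
  then have "string b \<subseteq> X"
    unfolding string_def by (intro span_minimal invariantD(1)[OF X(1)]) auto
  with X(2) show ?thesis by auto
qed

end

lemma f_nilpotent: "\<exists>n. \<forall>v. (f ^^ n) v = 0"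
  by (rule raising_operator_nilpotent[OF _ f.linear_axioms T.linear_axioms h_f]) simp_all

end

section \<open>Complete reducibility\<close>

context superspace
begin

text \<open>The grading clause of \<open>submodule\<close>, split off so that it can be combined
  with \<open>invariant\<close>.\<close>

definition graded :: "'v set \<Rightarrow> bool" where
  "graded W \<longleftrightarrow> (\<forall>w\<in>W. \<exists>a\<in>W \<inter> V 0. \<exists>b\<in>W \<inter> V 1. w = a + b)"

lemma homogeneous_split:
  assumes "subspace W" "w \<in> W \<inter> V i"
  shows "\<exists>a\<in>W \<inter> V 0. \<exists>b\<in>W \<inter> V 1. w = a + b"
proof -
  have "0 \<in> W \<inter> V j" for j
    using assms(1) subspace_component by (simp add: subspace_0)
  then show ?thesis
    using assms(2) bit_exhaust[of i] add_0_left[of w] add_0_right[of w] by metis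
qed

lemma graded_span:
  assumes "\<And>w. w \<in> A \<Longrightarrow> \<exists>a\<in>span A \<inter> V 0. \<exists>b\<in>span A \<inter> V 1. w = a + b"
  shows "graded (span A)"
  unfolding graded_def
proof
  note inter = subspace_inter[OF subspace_span subspace_component]
  fix w assume "w \<in> span A"
  then show "\<exists>a\<in>span A \<inter> V 0. \<exists>b\<in>span A \<inter> V 1. w = a + b"
  proof (induction rule: span_induct_alt)
    case base
    show ?case
      using subspace_0[OF inter] by (rule homogeneous_split[OF subspace_span])
  next
    case (step c x y)
    then obtain a b where ab: "a \<in> span A \<inter> V 0" "b \<in> span A \<inter> V 1" "y = a + b"
      by blast
    from assms[OF step(1)] obtain a' b' where
      a'b': "a' \<in> span A \<inter> V 0" "b' \<in> span A \<inter> V 1" "x = a' + b'"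
      by blast
    have "scale c a' + a \<in> span A \<inter> V 0" "scale c b' + b \<in> span A \<inter> V 1"
      by (intro subspace_add[OF inter] subspace_scale[OF inter] ab a'b')+
    moreover have "scale c x + y = (scale c a' + a) + (scale c b' + b)"
      by (simp add: ab a'b' algebra_simps)
    ultimately show ?case by blast
  qed
qed

text \<open>Homogeneous components are unique, so the splittings in \<open>U\<close> and in
  \<open>W\<close> coincide.\<close>

lemma graded_Int:
  assumes "graded U" "graded W"
  shows "graded (U \<inter> W)"
  unfolding graded_def
proof
  fix w assume "w \<in> U \<inter> W"
  then obtain a b a' b' where "a \<in> U \<inter> V 0" "b \<in> U \<inter> V 1" and w: "w = a + b"
    and "a' \<in> W \<inter> V 0" "b' \<in> W \<inter> V 1" and w': "w = a' + b'"
    using assms unfolding graded_def by blast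
  moreover have "a - a' = b' - b"
    using w w' by (simp add: algebra_simps)
  moreover have "a - a' \<in> V 0" "b' - b \<in> V 1"
    by (rule subspace_diff[OF subspace_component]; use calculation in blast)+
  ultimately have "a - a' \<in> V 0 \<inter> V 1"
    by (simp only: Int_iff)
  then have "a = a'"
    by (simp add: components_Int)
  with \<open>a - a' = b' - b\<close> have "b = b'"
    by simp
  with \<open>a = a'\<close> \<open>a \<in> U \<inter> V 0\<close> \<open>b \<in> U \<inter> V 1\<close> \<open>a' \<in> W \<inter> V 0\<close> \<open>b' \<in> W \<inter> V 1\<close> w
  show "\<exists>a\<in>U \<inter> W \<inter> V 0. \<exists>b\<in>U \<inter> W \<inter> V 1. w = a + b"
    by blast
qed

end

section \<open>Highest weight vectors and the sum of their strings\<close>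

locale graded_osp_operators = osp_operators scale Basis f g h + superspace scale V
  for scale :: "'k::field_char_0 \<Rightarrow> 'v::ab_group_add \<Rightarrow> 'v" and Basis :: "'v set"
    and f g h :: "'v \<Rightarrow> 'v" and V :: "bit \<Rightarrow> 'v set" +
  assumes total_UNIV: "total = UNIV"
    and f_in: "v \<in> V i \<Longrightarrow> f v \<in> V (1 + i)"
    and g_in: "v \<in> V i \<Longrightarrow> g v \<in> V (1 + i)"
begin

text \<open>Homogeneity is required so that the generated string is graded.\<close>

definition highest_weight_vectors :: "'v set" where
  "highest_weight_vectors =
     {b. b \<noteq> 0 \<and> f b = 0 \<and> (\<exists>i. b \<in> V i) \<and> (\<exists>m. h b = scale (of_nat (2 * m)) b)}"

lemma h_in: "v \<in> V i \<Longrightarrow> h v \<in> V i"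
  using f_in[OF g_in, of v i] g_in[OF f_in, of v i] bit_exhaust[of i]
  by (auto simp: h_eq subspace_add subspace_component)

lemma graded_string:
  assumes "b \<in> V i"
  shows "graded (string b)"
  unfolding string_def
proof (rule graded_span, rule homogeneous_split[OF subspace_span])
  fix w assume w: "w \<in> range (\<lambda>k. (g ^^ k) b)"
  then obtain k where "w = (g ^^ k) b" by auto
  moreover have "\<exists>j. (g ^^ k) b \<in> V j"
    using assms by (induction k) (auto dest: g_in)
  ultimately have "w \<in> V (SOME j. w \<in> V j)"
    by (auto intro: someI)
  then show "w \<in> span (range (\<lambda>k. (g ^^ k) b)) \<inter> V (SOME j. w \<in> V j)"
    using w by (auto intro: span_base)
qed

text \<open>The homogeneous components of \<open>v\<close> are killed by \<open>f\<close>
  separately, because their images have different parities. On each of them a product of distinct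
  factors \<open>h - 2j\<close> vanishes.\<close>

lemma kernel_in_span_highest_weight_vectors:
  assumes "f v = 0"
  shows "v \<in> span highest_weight_vectors"
proof -
  have homogeneous: "w \<in> span highest_weight_vectors" if w: "f w = 0" "w \<in> V i" for w i
  proof -
    define Z where "Z = {v. f v \<in> {0}} \<inter> V i"
    have Z: "subspace Z"
      unfolding Z_def
      by (intro subspace_inter f.subspace_linear_preimage subspace_single_0 subspace_component)
    have hZ: "h z \<in> Z" if "z \<in> Z" for z
      using that f_h_modulo[OF invariant_0, of z 0] h_in by (auto simp: Z_def)
    obtain n where "shift_prod (weights n) w = 0"
      using shift_prod_weights_in[OF invariant_0, of w] w by auto
    moreover have "distinct (weights n)"
      by (auto simp: weights_def distinct_map inj_on_def)
    ultimately have "w \<in> span {e \<in> Z. \<exists>a\<in>set (weights n). h e = scale a e}"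
      using w by (intro killed_by_shift_prod_in_span Z hZ) (auto simp: Z_def)
    \<comment> \<open>The zero vector meets the eigenvalue condition but is no highest weight
      vector; inserting it leaves the span unchanged.\<close>
    also have "\<dots> \<subseteq> span (insert 0 highest_weight_vectors)"
      by (intro span_mono) (auto simp: Z_def weights_def highest_weight_vectors_def)
    finally show ?thesis by simp
  qed
  obtain a b where ab: "v = a + b" "a \<in> V 0" "b \<in> V 1"
    using total_UNIV unfolding total_def by blast
  have "f a = - f b"
    using assms by (simp add: ab f.add eq_neg_iff_add_eq_0)
  moreover have "f a \<in> V 1" "f b \<in> V 0"
    using f_in[OF ab(2)] f_in[OF ab(3)] by simp_all
  ultimately have "f a \<in> V 0 \<inter> V 1"
    using subspace_neg[OF subspace_component] by simp
  then have "f a = 0" "f b = 0"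
    using components_Int \<open>f a = - f b\<close> by auto
  then show ?thesis
    unfolding ab(1)
    using \<open>f a = 0\<close> \<open>f b = 0\<close> ab by (intro span_add homogeneous)
qed

lemma span_strings: "span (\<Union>(string ` highest_weight_vectors)) = UNIV"
proof -
  define E where "E = (\<Union>b\<in>highest_weight_vectors. range (\<lambda>k. (g ^^ k) b))"
  define U where "U = span E"
  have weight: "\<exists>m. h b = scale (of_nat (2 * m)) b" and f_hw: "f b = 0"
    if "b \<in> highest_weight_vectors" for b
    using that by (auto simp: highest_weight_vectors_def)
  have string_E: "string b \<subseteq> U" if "b \<in> highest_weight_vectors" for b
    unfolding string_def U_def E_def using that by (intro span_mono) blast
  have inv: "invariant U"
    unfolding U_def
  proof (rule invariant_span)
    fix w assume "w \<in> E"
    then obtain b k where b: "b \<in> highest_weight_vectors" "w = (g ^^ k) b"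
      by (auto simp: E_def)
    then obtain m where "h b = scale (of_nat (2 * m)) b"
      using weight by blast
    from invariantD(2,3)[OF invariant_string[OF f_hw[OF b(1)] this] string_contains[of k b]]
    show "f w \<in> span E \<and> g w \<in> span E"
      using string_E[OF b(1)] b(2) by (auto simp: U_def)
  qed
  have kernel: "v \<in> U" if "f v = 0" for v
  proof -
    have "span highest_weight_vectors \<subseteq> U"
      using string_E string_contains[of 0] invariantD(1)[OF inv] by (intro span_minimal) auto
    then show ?thesis
      using kernel_in_span_highest_weight_vectors[OF that] by blast
  qed
  define X where "X = f ` U"
  have X: "subspace X"
    unfolding X_def U_def by (intro f.subspace_image subspace_span)
  have hX: "h x \<in> X" if "x \<in> X" for x
  proof -
    obtain u where u: "u \<in> U" "x = f u" using \<open>x \<in> X\<close> by (auto simp: X_def)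
    have "h x = f (h u + scale 2 u)" by (simp add: u h_f f.add f.scale)
    then show ?thesis
      unfolding X_def by (rule image_eqI) (simp add: u inv invariantD subspace_add subspace_scale)
  qed
  \<comment> \<open>Modulo \<open>X = f U\<close> only the bottom vectors \<open>g^(2m) b\<close> of
    the strings survive, with weights \<open>-2m\<close>; so the quotient has no positive
    weight.\<close>
  have positive: "x \<in> X" if "x \<in> U" "h x - scale (of_nat (2 * j + 2)) x \<in> X" for x j
  proof (rule not_eigenvalue_modulo[OF X hX])
    show "x \<in> span E" using \<open>x \<in> U\<close> by (simp add: U_def)
    show "h x - scale (of_nat (2 * j + 2)) x \<in> X" by fact
    fix e assume "e \<in> E"
    then obtain b k where b: "b \<in> highest_weight_vectors" and e: "e = (g ^^ k) b"
      by (auto simp: E_def)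
    from weight[OF b] obtain m where m: "h b = scale (of_nat (2 * m)) b" by blast
    note string = f_hw[OF b] m
    consider "k < 2 * m" | "k = 2 * m" | "k > 2 * m" by linarith
    then show "e \<in> X \<or> (\<exists>\<beta>. \<beta> \<noteq> of_nat (2 * j + 2) \<and> h e = scale \<beta> e)"
    proof cases
      case 1
      \<comment> \<open>Above the bottom, \<open>e\<close> is a multiple of the image under
        \<open>f\<close> of the next vector of the string.\<close>
      define c where "c = string_coeff m k"
      have c: "c \<noteq> 0" "f ((g ^^ Suc k) b) = scale c e"
        using string_coeff_nonzero[OF string 1] f_string[OF string, of k] by (simp_all add: c_def e)
      then have "e = f (scale (1 / c) ((g ^^ Suc k) b))"
        by (simp add: f.scale)
      moreover have "scale (1 / c) ((g ^^ Suc k) b) \<in> U"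
        unfolding U_def E_def using b by (intro span_scale span_base) blast
      ultimately show ?thesis by (auto simp: X_def)
    next
      case 2
      have "h e = scale (- of_nat (2 * m)) e"
        unfolding e h_string[OF string] by (simp add: 2 algebra_simps)
      moreover have "- of_nat (2 * m) \<noteq> (of_nat (2 * j + 2) :: 'k)"
      proof
        assume "- of_nat (2 * m) = (of_nat (2 * j + 2) :: 'k)"
        then have "(of_nat (2 * m + (2 * j + 2)) :: 'k) = 0"
          by (simp only: of_nat_add add.inverse_neutral eq_neg_iff_add_eq_0 neg_eq_iff_add_eq_0)
        then show False
          unfolding of_nat_eq_0_iff by simp
      qed
      ultimately show ?thesis by blast
    next
      case 3
      then show ?thesis
        using string_vanishes[OF string] X by (simp add: e subspace_0)
    qed
  qed
  have "U = UNIV"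
  proof (rule ccontr)
    assume "U \<noteq> UNIV"
    then obtain w where w: "w \<notin> U" by auto
    obtain N where "\<And>v. (f ^^ N) v = 0" using f_nilpotent by blast
    then have "(f ^^ N) w \<in> U" by (simp add: U_def span_zero)
    \<comment> \<open>The last power of \<open>f\<close> before the powers applied to
      \<open>w\<close> first enter \<open>U\<close>.\<close>
    then obtain n where n: "(f ^^ n) w \<notin> U" "(f ^^ Suc n) w \<in> U"
      using w ex_least_nat_less[of "\<lambda>n. (f ^^ n) w \<in> U" N] by auto
    define v where "v = (f ^^ n) w"
    have v: "v \<notin> U" "f v \<in> U" using n by (simp_all add: v_def)
    obtain n where n: "shift_prod (weights n) v \<in> U"
      using shift_prod_weights_in[OF inv v(2)] by blast
    \<comment> \<open>Moving \<open>f\<close> past a factor raises its root by two: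
      \<open>f (h - a) = (h - (a + 2)) f\<close>. The roots thereby become positive.\<close>
    have shift: "f (shift_prod as v) = shift_prod (map (\<lambda>a. a + 2) as) (f v)" for as
    proof (induction as)
      case (Cons a as)
      have "f (shift_prod (a # as) v) = h (f (shift_prod as v)) - scale (a + 2) (f (shift_prod as v))"
        by (simp add: h_f f.diff f.scale algebra_simps)
      then show ?case by (simp add: Cons)
    qed simp
    \<comment> \<open>The factors are stripped off from the outside, each being injective on
      \<open>U / X\<close> by \<open>positive\<close>.\<close>
    have descend: "x \<in> X"
      if "x \<in> U" "shift_prod (map (\<lambda>j. of_nat (2 * j + 2)) js) x \<in> X" for x and js :: "nat list"
      using that
    proof (induction js)
      case (Cons j js)
      let ?y = "shift_prod (map (\<lambda>j. of_nat (2 * j + 2)) js) x"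
      have "?y \<in> U"
        using shift_prod_in[of U] invariantD[OF inv] Cons.prems(1) by blast
      then have "?y \<in> X"
        using positive[of ?y j] Cons.prems(2) by simp
      then show ?case using Cons by blast
    qed simp
    have "f (shift_prod (weights n) v) \<in> X"
      using n by (simp add: X_def)
    also have "f (shift_prod (weights n) v) = shift_prod (map (\<lambda>j. of_nat (2 * j + 2)) [0..<n]) (f v)"
      by (simp add: shift weights_def o_def add.commute)
    finally have "f v \<in> X"
      using descend[OF v(2)] by blast
    then obtain u where u: "u \<in> U" "f v = f u" by (auto simp: X_def)
    \<comment> \<open>Subtracting \<open>u\<close> moves \<open>v\<close> into the kernel of
      \<open>f\<close>, which is contained in \<open>U\<close>.\<close>
    then have "v - u \<in> U"
      by (intro kernel) (simp add: f.diff)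
    then have "v - u + u \<in> U"
      using u invariantD(1)[OF inv] by (intro subspace_add)
    with v show False by simp
  qed
  moreover have "U \<subseteq> span (\<Union>(string ` highest_weight_vectors))"
    unfolding U_def E_def by (intro span_mono) (auto intro: string_contains)
  ultimately show ?thesis by auto
qed

end

section \<open>From a sum of irreducible submodules to a direct sum\<close>

context lie_superalgebra_module
begin

lemma submodule_span_Union:
  assumes "\<And>W. W \<in> S \<Longrightarrow> submodule W"
  shows "submodule (span (\<Union>S))"
proof -
  have "graded (span (\<Union>S))"
  proof (rule graded_span)
    fix w assume "w \<in> \<Union>S"
    then obtain W where W: "W \<in> S" "w \<in> W" by auto
    then obtain a b where "a \<in> W \<inter> V 0" "b \<in> W \<inter> V 1" "w = a + b"
      using assms[OF W(1)] unfolding submodule_def by blast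
    with W(1) show "\<exists>a\<in>span (\<Union>S) \<inter> V 0. \<exists>b\<in>span (\<Union>S) \<inter> V 1. w = a + b"
      by (intro bexI[of _ a] bexI[of _ b]) (auto intro: span_base)
  qed
  moreover have "act x w \<in> span (\<Union>S)" if x: "x \<in> L.total" and w: "w \<in> span (\<Union>S)" for x w
    using w
  proof (induction rule: span_induct_alt)
    case base
    show ?case using act_scale_right[OF x, of 0 0] by (simp add: span_zero)
  next
    case (step c w y)
    then obtain W where W: "W \<in> S" "w \<in> W" by auto
    then have "act x w \<in> W" using assms[OF W(1)] x by (auto simp: submodule_def)
    then have "act x w \<in> span (\<Union>S)" using W(1) by (auto intro: span_base)
    then show ?case
      by (simp add: act_add_right[OF x] act_scale_right[OF x] span_add span_scale step)
  qed
  ultimately show ?thesis by (auto simp: submodule_def graded_def)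
qed

lemma submodule_Int:
  assumes "submodule U" "submodule W"
  shows "submodule (U \<inter> W)"
proof -
  have "graded (U \<inter> W)"
    using assms by (intro graded_Int) (auto simp: submodule_def graded_def)
  then show ?thesis
    using assms by (auto simp: submodule_def graded_def intro: subspace_inter)
qed

text \<open>A spanning set of irreducible submodules of least cardinality is direct.\<close>

lemma completely_reducible_if_sum_of_irreducibles:
  fixes \<B> :: "'v set"
  assumes fin: "finite_dimensional_vector_space scale \<B>"
    and irr: "\<And>W. W \<in> \<W> \<Longrightarrow> irreducible_submodule W" and span_UNIV: "span (\<Union>\<W>) = UNIV"
  shows completely_reducible
proof -
  interpret finite_dimensional_vector_space scale \<B> by (rule fin)
  \<comment> \<open>A maximal independent set inside the union is finite, and one submodule for each
    of its elements already suffices to span.\<close>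
  obtain B where B: "B \<subseteq> \<Union>\<W>" "independent B" "\<Union>\<W> \<subseteq> span B"
    using maximal_independent_subset[of "\<Union>\<W>"] by blast
  then have "\<forall>b\<in>B. \<exists>W\<in>\<W>. b \<in> W" by blast
  then obtain W where W: "\<And>b. b \<in> B \<Longrightarrow> W b \<in> \<W> \<and> b \<in> W b" by metis
  define good where "good S \<longleftrightarrow> finite S \<and> S \<subseteq> \<W> \<and> span (\<Union>S) = UNIV" for S
  have "span (\<Union>\<W>) \<subseteq> span B"
    using B(3) by (intro span_minimal) auto
  moreover have "span B \<subseteq> span (\<Union>(W ` B))"
    using W by (intro span_mono) blast
  ultimately have "good (W ` B)"
    using W span_UNIV finiteI_independent[OF B(2)] by (auto simp: good_def)
  then obtain S where S: "good S" and least: "\<And>S'. good S' \<Longrightarrow> card S \<le> card S'"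
    using ex_has_least_nat[of good "W ` B" card] by auto
  have "W \<inter> span (\<Union>(S - {W})) = {0}" if W: "W \<in> S" for W
  proof -
    have sub: "submodule Y" if "Y \<in> S" for Y
      using that S irr unfolding good_def irreducible_submodule_def by blast
    have irrW: "irreducible_submodule W"
      using S irr W by (auto simp: good_def)
    have "submodule (W \<inter> span (\<Union>(S - {W})))"
      using W by (intro submodule_Int submodule_span_Union sub) auto
    then consider "W \<inter> span (\<Union>(S - {W})) = {0}" | "W \<subseteq> span (\<Union>(S - {W}))"
      using irrW unfolding irreducible_submodule_def by blast
    then show ?thesis
    proof cases
      case 2
      have "span (\<Union>S) \<subseteq> span (\<Union>(S - {W}))"
      proof (intro span_minimal subspace_span)
        show "\<Union>S \<subseteq> span (\<Union>(S - {W}))"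
          using 2 span_superset[of "\<Union>(S - {W})"] by blast
      qed
      then have "good (S - {W})"
        using S by (auto simp: good_def)
      from least[OF this] have "card S \<le> card (S - {W})" .
      moreover have "card (S - {W}) < card S"
        using S W by (intro card_Diff1_less) (auto simp: good_def)
      ultimately show ?thesis by simp
    qed simp
  qed
  then show ?thesis
    unfolding completely_reducible_def using S irr by (intro exI[of _ S]) (auto simp: good_def)
qed

end

section \<open>Translation between osp(1,2)-modules and the operators of the odd generators\<close>

theorem lemma2p6:
  fixes scale :: "'k::field_char_0 \<Rightarrow> 'v::ab_group_add \<Rightarrow> 'v"
    and V :: "bit \<Rightarrow> 'v set"
    and act :: "'k^3^3 \<Rightarrow> 'v \<Rightarrow> 'v"
    and Basis :: "'v set"
  assumes "lie_superalgebra_module matrix_scale osp12 supercommutator scale V act"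
    and "finite_dimensional_vector_space scale Basis"
  shows "lie_superalgebra_module.completely_reducible osp12 scale V act"
proof -
  interpret M: lie_superalgebra_module matrix_scale osp12 supercommutator scale V act by fact
  interpret finite_dimensional_vector_space scale Basis by fact
  have mem: "osp_H \<in> (osp12 0 :: ('k^3^3) set)" "osp_E_plus \<in> (osp12 0 :: ('k^3^3) set)"
    "osp_E_minus \<in> (osp12 0 :: ('k^3^3) set)" "osp_F_plus \<in> (osp12 1 :: ('k^3^3) set)"
    "osp_F_minus \<in> (osp12 1 :: ('k^3^3) set)"
    by (auto simp: osp12_def intro: mat.span_base)
  have total: "x \<in> osp12.total" if "x \<in> osp12 i" for x :: "'k^3^3" and i
  proof -
    have "0 \<in> (osp12 j :: ('k^3^3) set)" for j
      by (simp add: osp12_def mat.span_zero)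
    then have "\<exists>a b. x = a + b \<and> a \<in> osp12 0 \<and> b \<in> osp12 1"
      using that bit_exhaust[of i] add_0_left[of x] add_0_right[of x] by metis
    then show ?thesis unfolding osp12.total_def by blast
  qed
  have lin: "Vector_Spaces.linear scale scale (act x)" if "x \<in> osp12 i" for x i
    using M.act_add_right[OF total[OF that]] M.act_scale_right[OF total[OF that]]
    by (simp add: Vector_Spaces.linear_iff M.vector_space_axioms)
  interpret graded_osp_operators scale Basis "act osp_F_plus" "act osp_F_minus" "act osp_H" V
  proof -
    interpret H: Vector_Spaces.linear scale scale "act osp_H" by (rule lin[OF mem(1)])
    interpret Fp: Vector_Spaces.linear scale scale "act osp_F_plus" by (rule lin[OF mem(4)])
    interpret Fm: Vector_Spaces.linear scale scale "act osp_F_minus" by (rule lin[OF mem(5)])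
    show "graded_osp_operators scale Basis (act osp_F_plus) (act osp_F_minus) (act osp_H) V"
    proof
      fix v :: 'v and i
      show "act osp_H v = act osp_F_plus (act osp_F_minus v) + act osp_F_minus (act osp_F_plus v)"
        using M.act_bracket[OF mem(4,5), of v] by (simp add: osp_brackets super_sign_def)
      show "act osp_H (act osp_F_plus v) = act osp_F_plus (act osp_H v) + scale 2 (act osp_F_plus v)"
        using M.act_bracket[OF mem(1,4), of v] M.act_scale_left[OF total[OF mem(4)], of 2 v]
        by (simp add: osp_brackets super_sign_def)
      show "act osp_H (act osp_F_minus v) = act osp_F_minus (act osp_H v) - scale 2 (act osp_F_minus v)"
        using M.act_bracket[OF mem(1,5), of v] M.act_scale_left[OF total[OF mem(5)], of "-2" v]
        by (simp add: osp_brackets super_sign_def algebra_simps)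
      show "M.total = UNIV" by (rule M.total_eq_UNIV)
      show "act osp_F_plus v \<in> V (1 + i)" if "v \<in> V i"
        using M.act_in[OF mem(4) that] .
      show "act osp_F_minus v \<in> V (1 + i)" if "v \<in> V i"
        using M.act_in[OF mem(5) that] .
    qed
  qed
  \<comment> \<open>This carries irreducibility of strings among invariant subspaces over to
    irreducibility among graded submodules.\<close>
  have submodule_iff: "M.submodule W \<longleftrightarrow> invariant W \<and> M.graded W" for W
  proof -
    have "act x w \<in> W" if W: "invariant W" and x: "x \<in> osp12.total" and w: "w \<in> W" for x w
    proof -
      note W' = invariantD[OF W]
      have gen: "act y w \<in> W" if "y \<in> {osp_H, osp_E_plus, osp_E_minus, osp_F_plus, osp_F_minus}" for y
      proof -
        \<comment> \<open>For odd elements the superbracket is an anticommutator, so [F+, F+] = E+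
          makes E+ act as twice the square of F+.\<close>
        have "act osp_E_plus w = act osp_F_plus (act osp_F_plus w) + act osp_F_plus (act osp_F_plus w)"
          using M.act_bracket[OF mem(4,4), of w] by (simp add: osp_brackets super_sign_def)
        moreover have "act osp_E_minus w = act osp_F_minus (act osp_F_minus w) + act osp_F_minus (act osp_F_minus w)"
          using M.act_bracket[OF mem(5,5), of w] by (simp add: osp_brackets super_sign_def)
        ultimately show ?thesis
          using that w by (auto intro!: W'(2,3,4) M.subspace_add[OF W'(1)])
      qed
      have hom: "act y w \<in> W" if "y \<in> osp12 i" for y i
      proof -
        have sub: "mat.subspace (osp12 i :: ('k^3^3) set)"
          by (rule osp12.subspace_component)
        have "mat.subspace {y \<in> osp12 i. act y w \<in> W}"
        proof (rule mat.subspaceI)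
          have "act 0 w = 0"
            using M.act_scale_left[OF total[OF mem(1)], of 0 w] by simp
          then show "0 \<in> {y \<in> osp12 i. act y w \<in> W}"
            using mat.subspace_0[OF sub] M.subspace_0[OF W'(1)] by simp
        next
          fix y z assume "y \<in> {y \<in> osp12 i. act y w \<in> W}" "z \<in> {y \<in> osp12 i. act y w \<in> W}"
          then show "y + z \<in> {y \<in> osp12 i. act y w \<in> W}"
            using mat.subspace_add[OF sub] M.subspace_add[OF W'(1)] 
            by (simp add: M.act_add_left total[of _ i])
        next
          fix c y assume "y \<in> {y \<in> osp12 i. act y w \<in> W}"
          then show "matrix_scale c y \<in> {y \<in> osp12 i. act y w \<in> W}"
            using mat.subspace_scale[OF sub] M.subspace_scale[OF W'(1)]
            by (simp add: M.act_scale_left total[of _ i])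
        qed
        moreover have "(if i = 0 then {osp_H, osp_E_plus, osp_E_minus} else {osp_F_plus, osp_F_minus})
            \<subseteq> {y \<in> osp12 i. act y w \<in> W}"
          using gen bit_exhaust[of i] mem by auto
        ultimately have "osp12 i \<subseteq> {y \<in> osp12 i. act y w \<in> W}"
          unfolding osp12_def[of i] by (rule mat.span_minimal[rotated])
        with that show ?thesis by auto
      qed
      obtain y z where "x = y + z" "y \<in> osp12 0" "z \<in> osp12 1"
        using x by (auto simp: osp12.total_def)
      then show ?thesis
        using hom by (auto simp: M.act_add_left total intro!: M.subspace_add[OF W'(1)])
    qed
    then show ?thesis
      using total mem by (auto simp: M.submodule_def invariant_def M.graded_def)
  qed
  have "M.irreducible_submodule (string b)" if b: "b \<in> highest_weight_vectors" for b
  proof -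
    from b obtain i m where i: "b \<in> V i" and b': "b \<noteq> 0" "act osp_F_plus b = 0"
      "act osp_H b = scale (of_nat (2 * m)) b"
      by (auto simp: highest_weight_vectors_def)
    have "b \<in> string b" using string_contains[of 0 b] by simp
    then show ?thesis
      using b' i string_irreducible[OF b'(2,3)] invariant_string[OF b'(2,3)] graded_string[OF i]
      unfolding M.irreducible_submodule_def submodule_iff by blast
  qed
  then show ?thesis
    using span_strings
    by (intro M.completely_reducible_if_sum_of_irreducibles[of Basis "string ` highest_weight_vectors"])
      (auto intro: finite_dimensional_vector_space_axioms)
qed

end
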